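(* Let $S\subset\mathbb{R}^2$ be the Sierpinski Gasket and let $d$ be the function on $S\times S$ defined via code representations as follows: if $a,b\in S$ have code representations $a_1a_2a_3\ldots$ and $b_1b_2b_3\ldots$ with $a_i=b_i$ for $i=1,\ldots,k-1$ and $a_k\neq b_k$, then $$d(a,b)=\min\left\{\sum_{i=k+1}^{\infty}\frac{\alpha_i+\beta_i}{2^i}\,,\ \frac{1}{2^k}+\sum_{i=k+1}^{\infty}\frac{\gamma_i+\delta_i}{2^i}\right\},$$ where, for $i\ge k+1$, $\alpha_i=0$ if $a_i=b_k$ and $\alpha_i=1$ if $a_i\neq b_k$; $\beta_i=0$ if $b_i=a_k$ and $\beta_i=1$ if $b_i\neq a_k$; $\gamma_i=0$ if $a_i\neq a_k$ and $a_i\neq b_k$, and $\gamma_i=1$ otherwise; $\delta_i=0$ if $b_i\neq b_k$ and $b_i\neq a_k$, and $\delta_i=1$ otherwise; and $d(a,a)=0$. Then $d$ is a strictly intrinsic metric on $S$; that is, $d$ is a metric on $S$, and for all $a,b\in S$ the value $d(a,b)$ is the minimum (attained) of the Euclidean lengths of the rectifiable curves contained in $S$ joining $a$ and $b$.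
   Context: The Sierpinski Gasket $S\subset\mathbb{R}^2$ is the attractor (the unique nonempty compact set with $S=f_0(S)\cup f_1(S)\cup f_2(S)$) of the iterated function system $f_0(x,y)=(\tfrac12x,\tfrac12y)$, $f_1(x,y)=(\tfrac12x+\tfrac12,\tfrac12y)$, $f_2(x,y)=(\tfrac12x+\tfrac14,\tfrac12y+\tfrac{\sqrt3}{4})$. Code representations: for $a_1,\ldots,a_k\in\{0,1,2\}$ let $S_{a_1a_2\ldots a_k}=f_{a_1}\circ f_{a_2}\circ\cdots\circ f_{a_k}(S)$ (so $S_0,S_1,S_2$ are the left-bottom, right-bottom and upper parts of $S$, and similarly inside each sub-triangle). A sequence $a_1a_2a_3\ldots$ with $a_n\in\{0,1,2\}$ is a code representation of the point $a\in S$ if $\bigcap_{k=1}^\infty S_{a_1a_2\ldots a_k}=\{a\}$. Every point of $S$ has a code representation; it is unique except for junction points (intersection points of two of the three sub-triangles of some $S_{a_1\ldots a_k}$, or of $S$ itself), which have exactly two representations, of the form $a_1\ldots a_k\beta\alpha\alpha\alpha\ldots$ and $a_1\ldots a_k\alpha\beta\beta\beta\ldots$ with $\alpha\ne\beta$ in $\{0,1,2\}$. The value $d(a,b)$ is computed with any choice of code representations of $a$ and $b$; it does not depend on this choice. The intrinsic metric on $S$ is $\inf\{\delta : \delta \text{ is the (Euclidean) length of a rectifiable curve in } S \text{ joining } x \text{ and } y\}$; "strictly intrinsic" means that this infimum is attained, i.e. for every two points there is an admissible curve whose length equals the distance. *)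

theory Defs
  imports "HOL-Analysis.Analysis"
begin

text \<open>
  Curves are parametrised on \<open>{0..1}\<close>, as for \<^const>\<open>path\<close>.  Repeated nodes
  \<open>t i = t (Suc i)\<close> are allowed; they contribute nothing.
\<close>

definition inscribed_lengths :: "(real \<Rightarrow> 'a::metric_space) \<Rightarrow> real set" where
  "inscribed_lengths g =
     {\<Sum>i<n. dist (g (t i)) (g (t (Suc i))) | (n::nat) (t::nat \<Rightarrow> real).
        t 0 = 0 \<and> t n = 1 \<and> (\<forall>i<n. t i \<le> t (Suc i))}"

definition rectifiable :: "(real \<Rightarrow> 'a::metric_space) \<Rightarrow> bool" where
  "rectifiable g \<longleftrightarrow> path g \<and> bdd_above (inscribed_lengths g)"

definition curve_length :: "(real \<Rightarrow> 'a::metric_space) \<Rightarrow> real" where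
  "curve_length g = Sup (inscribed_lengths g)"

definition curves_joining ::
    "'a::metric_space set \<Rightarrow> 'a \<Rightarrow> 'a \<Rightarrow> (real \<Rightarrow> 'a) set" where
  "curves_joining S a b =
     {g. rectifiable g \<and> path_image g \<subseteq> S \<and> pathstart g = a \<and> pathfinish g = b}"

definition strictly_intrinsic :: "'a::metric_space set \<Rightarrow> ('a \<Rightarrow> 'a \<Rightarrow> real) \<Rightarrow> bool" where
  "strictly_intrinsic S d \<longleftrightarrow>
     (\<forall>a\<in>S. \<forall>b\<in>S.
        (\<exists>g\<in>curves_joining S a b. curve_length g = d a b) \<and>
        (\<forall>g\<in>curves_joining S a b. d a b \<le> curve_length g))"

text \<open>The product metric on \<^typ>\<open>real \<times> real\<close> is the Euclidean one.\<close>

definition sg_map :: "nat \<Rightarrow> real \<times> real \<Rightarrow> real \<times> real" where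
  "sg_map j = (\<lambda>(x, y).
     if j = 0 then (x / 2, y / 2)
     else if j = 1 then (x / 2 + 1 / 2, y / 2)
     else (x / 2 + 1 / 4, y / 2 + sqrt 3 / 4))"

definition gasket :: "(real \<times> real) set" where
  "gasket = (THE S. compact S \<and> S \<noteq> {} \<and>
                    S = sg_map 0 ` S \<union> sg_map 1 ` S \<union> sg_map 2 ` S)"

text \<open>A word acts with its first letter outermost: \<open>foldr sg_map [j, k, l] = sg_map j \<circ> sg_map k \<circ> sg_map l\<close>.\<close>

definition sg_cell :: "nat list \<Rightarrow> (real \<times> real) set" where
  "sg_cell w = foldr sg_map w ` gasket"

text \<open>Code sequences are indexed from 1; the value \<open>c 0\<close> is irrelevant throughout.\<close>

definition is_code :: "(nat \<Rightarrow> nat) \<Rightarrow> real \<times> real \<Rightarrow> bool" where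
  "is_code c p \<longleftrightarrow>
     (\<forall>n\<ge>1. c n \<in> {0, 1, 2}) \<and> (\<Inter>k\<in>{1..}. sg_cell (map c [1..<Suc k])) = {p}"

text \<open>
  In both series the summation index \<open>i \<ge> k + 1\<close> is written as \<open>k + 1 + m\<close> with \<open>m \<ge> 0\<close>.
\<close>

definition code_dist :: "(nat \<Rightarrow> nat) \<Rightarrow> (nat \<Rightarrow> nat) \<Rightarrow> real" where
  "code_dist a b =
     (if \<forall>n\<ge>1. a n = b n then 0
      else let k = (LEAST n. 1 \<le> n \<and> a n \<noteq> b n);
               \<alpha> = (\<lambda>i. if a i = b k then 0 else 1 :: real);
               \<beta> = (\<lambda>i. if b i = a k then 0 else 1 :: real);
               \<gamma> = (\<lambda>i. if a i \<noteq> a k \<and> a i \<noteq> b k then 0 else 1 :: real);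
               \<delta> = (\<lambda>i. if b i \<noteq> b k \<and> b i \<noteq> a k then 0 else 1 :: real)
           in min (\<Sum>m. (\<alpha> (k + 1 + m) + \<beta> (k + 1 + m)) / 2 ^ (k + 1 + m))
                  (1 / 2 ^ k + (\<Sum>m. (\<gamma> (k + 1 + m) + \<delta> (k + 1 + m)) / 2 ^ (k + 1 + m))))"

text \<open>
  The description operator expresses that the value does not depend on the chosen codes: it
  determines a value only if all codes of \<open>a\<close> and \<open>b\<close> give the same one.
  The value 0 outside the gasket is a totalisation: \<^const>\<open>Metric_space\<close> asks for
  nonnegativity and symmetry on the whole type.
\<close>

definition gasket_dist :: "real \<times> real \<Rightarrow> real \<times> real \<Rightarrow> real" where
  "gasket_dist a b =
     (if a \<in> gasket \<and> b \<in> gasket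
      then THE r. \<exists>u v. is_code u a \<and> is_code v b \<and> r = code_dist u v
      else 0)"

end

theory Submission
  imports Defs "HOL-Complex_Analysis.Great_Picard"
begin

text \<open>
  The formula is compared with curve lengths from both sides, and everything else follows from this
  comparison: independence of the chosen codes, the metric axioms and attainment.

  The key quantity is the barycentric coordinate \<open>bary j\<close>.  The letters \<open>j\<close> in a code of \<open>x\<close> are the
  binary digits of \<open>bary j x\<close>, so the series of the formula are values of \<open>1 - bary j\<close>, scaled to the
  size of the cell (\<open>code_dist_geometric\<close>).  Moreover \<open>1 - bary j x\<close> is the intrinsic distance from \<open>x\<close>
  to the corner \<open>j\<close>.  An arc of this length runs along the sides of ever smaller cells towards \<open>x\<close>
  (\<open>joined_corner\<close>; the limit is taken with the Arzela-Ascoli theorem).  No curve is shorter, because a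
  curve leaves a cell only through its three corners, and each such passage costs at least the
  Euclidean distance between the corners involved (\<open>corner_distance_lower\<close>).

  Now let \<open>a\<close> and \<open>b\<close> lie in different subcells \<open>i\<close> and \<open>j\<close> of a common smallest cell.  The two
  subcells share a corner, and each shares one with the third subcell \<open>l\<close>.  A curve from \<open>a\<close> to \<open>b\<close> either
  uses the common corner, at the cost of two corner distances, or crosses \<open>l\<close> at the cost of two corner
  distances and one side; a way over an outer corner is never better than the first option.  The
  minimum of the two costs is the formula: it is a lower bound for every curve
  (\<open>adjacent_cells_distance_lower\<close>), and an explicit arc has at most this length (\<open>joined_code_dist\<close>).
\<close>

section \<open>Corners, barycentric coordinates and cell maps\<close>

definition corner :: "nat \<Rightarrow> real \<times> real" where
  "corner j = (if j = 0 then (0, 0) else if j = 1 then (1, 0) else (1 / 2, sqrt 3 / 2))"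

text \<open>
  These are the barycentric coordinates with respect to the three corners.  They carry the metric:
  \<open>bary j x\<close> is the number whose binary digits mark the letters \<open>j\<close> in a code of \<open>x\<close>, and
  \<open>1 - bary j x\<close> turns out to be the intrinsic distance from \<open>x\<close> to the corner \<open>j\<close>.
\<close>

definition bary :: "nat \<Rightarrow> real \<times> real \<Rightarrow> real" where
  "bary j = (\<lambda>(x, y). if j = 0 then 1 - x - y / sqrt 3
                      else if j = 1 then x - y / sqrt 3 else 2 * y / sqrt 3)"

lemma sg_map_eq: "sg_map j x = (1 / 2) *\<^sub>R (x + corner j)"
  by (cases x) (auto simp: sg_map_def corner_def algebra_simps)

lemma sg_map_corner_self [simp]: "sg_map j (corner j) = corner j"
  by (simp add: sg_map_eq corner_def)

lemma sg_map_corner_commute: "sg_map i (corner j) = sg_map j (corner i)"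
  by (simp add: sg_map_eq add.commute)

lemma bary_corner:
  "\<lbrakk>i \<in> {0,1,2}; j \<in> {0,1,2}\<rbrakk> \<Longrightarrow> bary i (corner j) = (if i = j then 1 else 0)"
  by (auto simp: bary_def corner_def)

lemma bary_sg_map:
  "\<lbrakk>i \<in> {0,1,2}; j \<in> {0,1,2}\<rbrakk> \<Longrightarrow>
    bary i (sg_map j x) = (bary i x + (if i = j then 1 else 0)) / 2"
proof (cases x)
  case (Pair a b)
  have "(b / 2 + sqrt 3 / 4) / sqrt 3 = b / sqrt 3 / 2 + 1 / 4"
    "2 * (b / 2 + sqrt 3 / 4) / sqrt 3 = b / sqrt 3 + 1 / 2"
    by (simp_all add: field_simps)
  moreover assume "i \<in> {0,1,2}" "j \<in> {0,1,2}"
  ultimately show ?thesis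
    using Pair by (auto simp: bary_def sg_map_def)
qed

lemma bary_sum: "bary 0 x + bary 1 x + bary 2 x = 1"
  by (cases x) (auto simp: bary_def field_simps)

lemma bary_inject:
  assumes "\<And>i. i \<in> {0,1,2} \<Longrightarrow> bary i x = bary i y" shows "x = y"
  using assms[of 1] assms[of 2] by (cases x; cases y) (auto simp: bary_def)

lemma continuous_on_bary: "continuous_on A (bary j)"
  unfolding bary_def case_prod_unfold
  by (cases "j = 0"; cases "j = 1") (auto intro!: continuous_intros)

lemma dist_corner:
  "\<lbrakk>i \<in> {0,1,2}; j \<in> {0,1,2}; i \<noteq> j\<rbrakk> \<Longrightarrow> dist (corner i) (corner j) = 1"
  by (auto simp: corner_def dist_Pair_Pair dist_real_def power_divide)

lemma norm_corner_le: "norm (corner j) \<le> 1"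
  by (auto simp: corner_def norm_Pair power_divide)

lemma dist_sg_map: "dist (sg_map j x) (sg_map j y) = dist x y / 2"
  by (simp add: sg_map_eq dist_norm flip: scaleR_diff_right)

lemma continuous_on_sg_map: "continuous_on A (sg_map j)"
proof -
  have "sg_map j = (\<lambda>x. (1 / 2) *\<^sub>R (x + corner j))"
    by (simp add: fun_eq_iff sg_map_eq)
  then show ?thesis by (simp add: continuous_intros)
qed

abbreviation cell_map :: "nat list \<Rightarrow> real \<times> real \<Rightarrow> real \<times> real" where
  "cell_map w \<equiv> foldr sg_map w"

lemma dist_cell_map: "dist (cell_map w x) (cell_map w y) = dist x y / 2 ^ length w"
  by (induction w) (auto simp: dist_sg_map)

lemma cell_map_eq_iff [simp]: "cell_map w x = cell_map w y \<longleftrightarrow> x = y"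
  using dist_cell_map[of w x y] by (metis dist_eq_0_iff divide_eq_0_iff power_not_zero zero_neq_numeral)

lemma cell_map_mem_image_iff [simp]: "cell_map w x \<in> cell_map w ` A \<longleftrightarrow> x \<in> A"
  by (rule inj_image_mem_iff) (simp add: inj_def)

lemma sg_map_eq_iff [simp]: "sg_map j x = sg_map j y \<longleftrightarrow> x = y"
  using cell_map_eq_iff[of "[j]" x y] by simp

lemma continuous_on_cell_map: "continuous_on A (cell_map w)"
proof (induction w)
  case (Cons j w)
  show ?case
    using continuous_on_compose[OF Cons continuous_on_sg_map[of _ j]] by simp
qed auto

section \<open>The gasket as the unique attractor\<close>

text \<open>
  Self-similarity propagates crude proximity to all scales: a bounded set covered by its own three
  images can be pulled back arbitrarily often, and each step halves the distance to any set that
  the three maps preserve.  The lemma serves three purposes: uniqueness of the attractor, the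
  inclusion of the triangle sides in the gasket, and the inclusion of the gasket in the triangle.
\<close>

lemma attractor_subset:
  assumes "bounded K" and K: "K \<subseteq> (\<Union>j\<in>{0,1,2}. sg_map j ` K)"
    and "closed Q" "Q \<noteq> {}" and Q: "\<And>j x. \<lbrakk>j \<in> {0,1,2}; x \<in> Q\<rbrakk> \<Longrightarrow> sg_map j x \<in> Q"
  shows "K \<subseteq> Q"
proof
  obtain q where q: "q \<in> Q" using \<open>Q \<noteq> {}\<close> by blast
  obtain C where C: "\<And>z. z \<in> K \<Longrightarrow> dist z q \<le> C"
    using \<open>bounded K\<close> by (metis bounded_any_center dist_commute)
  have close: "\<exists>y\<in>Q. dist z y \<le> C / 2 ^ n" if "z \<in> K" for z n
    using that
  proof (induction n arbitrary: z)
    case 0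
    then show ?case using q C[OF 0] by (intro bexI[of _ q]) simp_all
  next
    case (Suc n)
    then obtain j z' where j: "j \<in> {0,1,2}" and z': "z' \<in> K" "z = sg_map j z'"
      using K by blast
    then obtain y where "y \<in> Q" "dist z' y \<le> C / 2 ^ n" using Suc.IH by blast
    then have "sg_map j y \<in> Q" "dist z (sg_map j y) \<le> C / 2 ^ Suc n"
      using Q j z' by (auto simp: dist_sg_map field_simps)
    then show ?case by blast
  qed
  fix z assume "z \<in> K"
  have "z \<in> closure Q"
    unfolding closure_approachable
  proof (intro allI impI)
    fix e :: real assume "0 < e"
    have "(\<lambda>n. C / 2 ^ n) \<longlonglongrightarrow> 0"
      by (intro LIMSEQ_divide_realpow_zero) simp
    then obtain n where "C / 2 ^ n < e"
      by (metis \<open>0 < e\<close> eventually_sequentially order_tendstoD(2) order_refl)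
    then show "\<exists>y\<in>Q. dist y z < e"
      using close[OF \<open>z \<in> K\<close>, of n] by (metis dist_commute order_le_less_trans)
  qed
  then show "z \<in> Q" using \<open>closed Q\<close> by simp
qed

text \<open>
  The first corner is a fixed point of one of the maps, so its orbit is reproduced by the three maps
  exactly; taking the closure makes it compact and preserves the equation.
\<close>

inductive_set orbit :: "(real \<times> real) set" where
  "corner 0 \<in> orbit"
| "\<lbrakk>j \<in> {0,1,2}; x \<in> orbit\<rbrakk> \<Longrightarrow> sg_map j x \<in> orbit"

lemma orbit_eq: "orbit = (\<Union>j\<in>{0,1,2}. sg_map j ` orbit)"
proof
  have "x \<in> (\<Union>j\<in>{0,1,2}. sg_map j ` orbit)" if "x \<in> orbit" for x
    using that
  proof cases
    case 1
    then have "x = sg_map 0 (corner 0)" by simp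
    then show ?thesis using orbit.intros(1) by blast
  qed blast
  then show "orbit \<subseteq> (\<Union>j\<in>{0,1,2}. sg_map j ` orbit)" by blast
  show "(\<Union>j\<in>{0,1,2}. sg_map j ` orbit) \<subseteq> orbit"
    using orbit.intros(2) by auto
qed

lemma bounded_orbit: "bounded orbit"
proof (rule boundedI)
  fix x assume "x \<in> orbit"
  then show "norm x \<le> 1"
  proof induction
    case (2 j x)
    have "norm (x + corner j) \<le> 2"
      using norm_triangle_ineq[of x "corner j"] norm_corner_le[of j] 2 by linarith
    then show ?case by (simp add: sg_map_eq)
  qed (simp add: corner_def)
qed

lemma closure_orbit_eq: "closure orbit = (\<Union>j\<in>{0,1,2}. sg_map j ` closure orbit)"
proof
  have comp: "compact (\<Union>j\<in>{0,1,2}. sg_map j ` closure orbit)"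
    by (intro compact_UN compact_continuous_image continuous_on_sg_map)
      (auto simp: bounded_orbit compact_closure)
  have "orbit \<subseteq> (\<Union>j\<in>{0,1,2}. sg_map j ` closure orbit)"
    by (rule order_trans[OF equalityD1[OF orbit_eq]])
      (intro UN_mono image_mono closure_subset order_refl)
  then show "closure orbit \<subseteq> (\<Union>j\<in>{0,1,2}. sg_map j ` closure orbit)"
    using comp by (rule closure_minimal[OF _ compact_imp_closed])
  have "sg_map j ` closure orbit \<subseteq> closure orbit" if "j \<in> {0,1,2}" for j
  proof (rule image_closure_subset[OF continuous_on_sg_map closed_closure])
    show "sg_map j ` orbit \<subseteq> closure orbit"
      using orbit.intros(2)[OF that] closure_subset[of orbit] by blast
  qed
  then show "(\<Union>j\<in>{0,1,2}. sg_map j ` closure orbit) \<subseteq> closure orbit" by blast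
qed

lemma gasket_eq_closure_orbit: "gasket = closure orbit"
proof -
  have UN_letters: "(\<Union>j\<in>{0,1,2}. sg_map j ` S)
      = sg_map 0 ` S \<union> sg_map 1 ` S \<union> sg_map 2 ` S" for S by auto
  have ne: "closure orbit \<noteq> {}"
    using orbit.intros(1) by auto
  have comp: "compact (closure orbit)"
    by (simp add: bounded_orbit compact_closure)
  have sub: "A \<subseteq> B"
    if "compact A" "compact B" "B \<noteq> {}" and A: "A = (\<Union>j\<in>{0,1,2}. sg_map j ` A)"
      and B: "B = (\<Union>j\<in>{0,1,2}. sg_map j ` B)" for A B
  proof (rule attractor_subset)
    show "sg_map j x \<in> B" if "j \<in> {0,1,2}" "x \<in> B" for j x
      using that B by blast
    show "A \<subseteq> (\<Union>j\<in>{0,1,2}. sg_map j ` A)"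
      using A by (rule equalityD1)
  qed (use that(1-3) in \<open>simp_all add: compact_imp_bounded compact_imp_closed\<close>)
  show ?thesis
    unfolding gasket_def UN_letters[symmetric]
  proof (rule the_equality)
    show "compact (closure orbit) \<and> closure orbit \<noteq> {}
        \<and> closure orbit = (\<Union>j\<in>{0,1,2}. sg_map j ` closure orbit)"
      using comp ne closure_orbit_eq by blast
    fix S assume "compact S \<and> S \<noteq> {} \<and> S = (\<Union>j\<in>{0,1,2}. sg_map j ` S)"
    then show "S = closure orbit"
      using sub comp ne closure_orbit_eq by (metis subset_antisym)
  qed
qed

lemma compact_gasket: "compact gasket"
  by (simp add: gasket_eq_closure_orbit bounded_orbit compact_closure)

lemma gasket_eq: "gasket = (\<Union>j\<in>{0,1,2}. sg_map j ` gasket)"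
  using closure_orbit_eq by (simp add: gasket_eq_closure_orbit)

lemma sg_map_gasket: "\<lbrakk>j \<in> {0,1,2}; x \<in> gasket\<rbrakk> \<Longrightarrow> sg_map j x \<in> gasket"
  using gasket_eq by blast

lemma gasket_cases:
  assumes "x \<in> gasket"
  obtains j y where "j \<in> {0,1,2}" "y \<in> gasket" "x = sg_map j y"
  using assms gasket_eq by blast

lemma cell_map_gasket: "\<lbrakk>set w \<subseteq> {0,1,2}; x \<in> gasket\<rbrakk> \<Longrightarrow> cell_map w x \<in> gasket"
  by (induction w) (auto intro: sg_map_gasket)

text \<open>Each side of the triangle is the union of two half-size copies of itself.\<close>

lemma closed_segment_corners_subset_gasket:
  assumes "i \<in> {0,1,2}" "j \<in> {0,1,2}"
  shows "closed_segment (corner i) (corner j) \<subseteq> gasket"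
proof (rule attractor_subset)
  show "closed_segment (corner i) (corner j)
          \<subseteq> (\<Union>k\<in>{0,1,2}. sg_map k ` closed_segment (corner i) (corner j))"
  proof
    fix z assume "z \<in> closed_segment (corner i) (corner j)"
    then obtain u where u: "0 \<le> u" "u \<le> 1" "z = (1 - u) *\<^sub>R corner i + u *\<^sub>R corner j"
      by (auto simp: in_segment)
    show "z \<in> (\<Union>k\<in>{0,1,2}. sg_map k ` closed_segment (corner i) (corner j))"
    proof (cases "u \<le> 1 / 2")
      case True
      let ?y = "(1 - 2 * u) *\<^sub>R corner i + (2 * u) *\<^sub>R corner j"
      have "?y \<in> closed_segment (corner i) (corner j)"
        using True u unfolding in_segment by (intro exI[of _ "2 * u"]) auto
      moreover have "z = sg_map i ?y"
        by (simp add: u sg_map_eq algebra_simps flip: scaleR_add_left)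
      ultimately show ?thesis using assms by blast
    next
      case False
      let ?y = "(1 - (2 * u - 1)) *\<^sub>R corner i + (2 * u - 1) *\<^sub>R corner j"
      have "?y \<in> closed_segment (corner i) (corner j)"
        using False u unfolding in_segment by (intro exI[of _ "2 * u - 1"]) auto
      moreover have "z = sg_map j ?y"
        by (simp add: u sg_map_eq algebra_simps flip: scaleR_add_left)
      ultimately show ?thesis using assms by blast
    qed
  qed
  show "gasket \<noteq> {}"
    using orbit.intros(1) by (auto simp: gasket_eq_closure_orbit)
qed (simp_all add: compact_gasket compact_imp_closed compact_imp_bounded sg_map_gasket
       del: insert_iff)

lemma corner_in_gasket: "j \<in> {0,1,2} \<Longrightarrow> corner j \<in> gasket"
  using closed_segment_corners_subset_gasket[of j j] by auto

lemma bary_nonneg: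
  assumes "x \<in> gasket" "j \<in> {0,1,2}" shows "0 \<le> bary j x"
proof -
  have "gasket \<subseteq> {x. 0 \<le> bary j x}"
  proof (rule attractor_subset)
    show "closed {x. 0 \<le> bary j x}"
      by (intro closed_Collect_le continuous_on_bary continuous_on_const)
    show "{x. 0 \<le> bary j x} \<noteq> {}"
    proof -
      have "bary j (corner j) = 1" using bary_corner[of j j] assms by simp
      then have "corner j \<in> {x. 0 \<le> bary j x}" by simp
      then show ?thesis by blast
    qed
    show "gasket \<subseteq> (\<Union>j\<in>{0,1,2}. sg_map j ` gasket)"
      using gasket_eq by (rule equalityD1)
    show "sg_map i x \<in> {x. 0 \<le> bary j x}" if "i \<in> {0,1,2}" "x \<in> {x. 0 \<le> bary j x}" for i x
      using bary_sg_map[of j i x] that assms by (simp split: if_splits)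
  qed (simp add: compact_gasket compact_imp_bounded)
  then show ?thesis using assms by blast
qed

lemma bary_le_one:
  assumes "x \<in> gasket" "j \<in> {0,1,2}" shows "bary j x \<le> 1"
  using bary_sum[of x] bary_nonneg[OF assms(1), of 0] bary_nonneg[OF assms(1), of 1]
    bary_nonneg[OF assms(1), of 2] assms(2) by auto

lemma third_letter:
  assumes "i \<in> {0,1,2}" "j \<in> {0,1,2}" "i \<noteq> (j::nat)"
  obtains l where "l \<in> {0,1,2}" "l \<noteq> i" "l \<noteq> j" "{0,1,2} = {i, j, l}"
proof
  have *: "i = 0 \<or> i = 1 \<or> i = 2" "j = 0 \<or> j = 1 \<or> j = 2"
    using assms by simp_all
  show "3 - i - j \<in> {0,1,2}" "3 - i - j \<noteq> i" "3 - i - j \<noteq> j"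
    using * assms(3) by auto
  show "{0,1,2} = {i, j, 3 - i - j}"
    unfolding set_eq_iff insert_iff empty_iff using * assms(3) by presburger
qed

text \<open>
  On the subtriangle \<open>i\<close> the \<open>i\<close>-th barycentric coordinate is at least \<open>1 / 2\<close>; two coordinates with
  this property exhaust the total 1, so two subtriangles meet only in the midpoint of a side.
\<close>

lemma subtriangles_meet:
  assumes x: "x \<in> sg_map i ` gasket" "x \<in> sg_map j ` gasket"
    and ij: "i \<in> {0,1,2}" "j \<in> {0,1,2}" "i \<noteq> j"
  shows "x = sg_map i (corner j)"
proof -
  obtain l where l: "l \<in> {0,1,2}" "l \<noteq> i" "l \<noteq> j" "{0,1,2} = {i, j, l}"
    using third_letter ij by metis
  have "bary i x + bary j x + bary l x = bary 0 x + bary 1 x + bary 2 x"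
    using ij l(1-3) by auto
  then have sum: "bary i x + bary j x + bary l x = 1"
    using bary_sum by simp
  have half: "1 / 2 \<le> bary k x" if "x \<in> sg_map k ` gasket" "k \<in> {0,1,2}" for k
    using that bary_sg_map[of k k] bary_nonneg[of _ k] by auto
  have "x \<in> gasket" using x ij sg_map_gasket by blast
  then have "0 \<le> bary l x" using bary_nonneg l by simp
  with half[OF x(1) ij(1)] half[OF x(2) ij(2)] sum
  have *: "bary i x = 1 / 2" "bary j x = 1 / 2" "bary l x = 0"
    by linarith+
  show ?thesis
  proof (rule bary_inject)
    fix k :: nat assume k: "k \<in> {0,1,2}"
    then have "k = i \<or> k = j \<or> k = l" using l(4) by blast
    then show "bary k x = bary k (sg_map i (corner j))"
      using * ij l k by (auto simp: bary_sg_map bary_corner simp del: insert_iff)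
  qed
qed

lemma corner_notin_subtriangle:
  assumes "i \<in> {0,1,2}" "j \<in> {0,1,2}" "i \<noteq> j"
  shows "corner j \<notin> sg_map i ` gasket"
proof
  assume "corner j \<in> sg_map i ` gasket"
  then obtain y where "y \<in> gasket" "corner j = sg_map i y" by blast
  then show False
    using bary_sg_map[of i i y] bary_corner[of i j] bary_nonneg[of y i] assms by simp
qed

section \<open>Arcs of bounded length\<close>

text \<open>
  A parametrisation with Lipschitz constant 1 on \<open>{0..L}\<close> witnesses length at most \<open>L\<close>.  Such arcs are
  closed under concatenation, reversal, rescaling and limits without any computation of lengths.
\<close>

definition joined :: "'a::metric_space set \<Rightarrow> 'a \<Rightarrow> 'a \<Rightarrow> real \<Rightarrow> bool" where
  "joined S a b L \<longleftrightarrow>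
     (\<exists>h. 1-lipschitz_on {0..L} h \<and> h ` {0..L} \<subseteq> S \<and> h 0 = a \<and> h L = b \<and> 0 \<le> L)"

lemma joined_refl: "\<lbrakk>a \<in> S; 0 \<le> L\<rbrakk> \<Longrightarrow> joined S a a L"
  unfolding joined_def by (rule exI[of _ "\<lambda>_. a"]) (auto intro: lipschitz_onI)

lemma joined_trans:
  assumes "joined S a b L" "joined S b c M" shows "joined S a c (L + M)"
proof -
  from assms obtain h k where h: "1-lipschitz_on {0..L} h" "h ` {0..L} \<subseteq> S" "h 0 = a" "h L = b" "0 \<le> L"
    and k: "1-lipschitz_on {0..M} k" "k ` {0..M} \<subseteq> S" "k 0 = b" "k M = c" "0 \<le> M"
    unfolding joined_def by blast
  let ?f = "\<lambda>x. if x \<le> L then h x else k (x - L)"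
  have "1-lipschitz_on {L..L + M} (\<lambda>x. k (x - L))"
  proof (rule lipschitz_onI)
    fix x y assume "x \<in> {L..L + M}" "y \<in> {L..L + M}"
    then show "dist (k (x - L)) (k (y - L)) \<le> 1 * dist x y"
      using lipschitz_onD[OF k(1), of "x - L" "y - L"] by (auto simp: dist_real_def)
  qed simp
  then have "1-lipschitz_on {0..L + M} ?f"
    using h k by (intro lipschitz_on_concat) auto
  moreover have "?f ` {0..L + M} \<subseteq> S"
  proof (rule image_subsetI)
    fix x assume "x \<in> {0..L + M}"
    then show "?f x \<in> S"
      using h(2) k(2) by (cases "x \<le> L") (auto simp: image_subset_iff)
  qed
  moreover have "?f 0 = a" "?f (L + M) = c"
    using h(3-5) k(3-5) by (cases "M = 0"; simp)+
  ultimately show ?thesis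
    using h(5) k(5) unfolding joined_def by (intro exI[of _ ?f]) auto
qed

lemma joined_sym:
  assumes "joined S a b L" shows "joined S b a L"
proof -
  from assms obtain h where h: "1-lipschitz_on {0..L} h" "h ` {0..L} \<subseteq> S" "h 0 = a" "h L = b" "0 \<le> L"
    unfolding joined_def by blast
  have "1-lipschitz_on {0..L} (\<lambda>x. h (L - x))"
  proof (rule lipschitz_onI)
    fix x y assume "x \<in> {0..L}" "y \<in> {0..L}"
    then show "dist (h (L - x)) (h (L - y)) \<le> 1 * dist x y"
      using lipschitz_onD[OF h(1), of "L - x" "L - y"] by (auto simp: dist_real_def)
  qed simp
  then show ?thesis
    unfolding joined_def using h by (intro exI[of _ "\<lambda>x. h (L - x)"]) auto
qed

lemma joined_segment:
  fixes a b :: "'a::real_normed_vector"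
  assumes "closed_segment a b \<subseteq> S" shows "joined S a b (dist a b)"
proof (cases "a = b")
  case True
  then show ?thesis using assms by (simp add: joined_refl)
next
  case False
  let ?d = "dist a b"
  let ?h = "\<lambda>x. a + (x / ?d) *\<^sub>R (b - a)"
  have d: "0 < ?d" using False by simp
  have "dist (?h x) (?h y) = dist x y" for x y :: real
  proof -
    have "?h x - ?h y = ((x - y) / ?d) *\<^sub>R (b - a)"
      by (simp add: algebra_simps diff_divide_distrib)
    then have "dist (?h x) (?h y) = \<bar>(x - y) / ?d\<bar> * ?d"
      by (metis dist_norm norm_scaleR norm_minus_commute)
    then show ?thesis using d by (simp add: dist_real_def)
  qed
  then have "1-lipschitz_on {0..?d} ?h"
    by (auto intro: lipschitz_onI)
  moreover have "?h x \<in> closed_segment a b" if "x \<in> {0..?d}" for x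
    using that d unfolding in_segment
    by (intro exI[of _ "x / ?d"]) (auto simp: algebra_simps)
  ultimately show ?thesis
    unfolding joined_def using assms d by (intro exI[of _ ?h]) auto
qed

text \<open>
  A limit of arcs of length at most \<open>L\<close> is again such an arc: 1-Lipschitz parametrisations on a fixed
  interval are equicontinuous, so a subsequence converges uniformly.
\<close>

lemma joined_limit:
  fixes S :: "'a::{real_normed_vector,heine_borel} set"
  assumes "compact S" and joined: "\<And>n::nat. joined S a (y n) L" and lim: "y \<longlonglongrightarrow> b"
  shows "joined S a b L"
proof -
  obtain h where h: "\<And>n. 1-lipschitz_on {0..L} (h n)" "\<And>n. h n ` {0..L} \<subseteq> S"
      "\<And>n. h n 0 = a" "\<And>n. h n L = y n" and "0 \<le> L"
    using joined unfolding joined_def by metis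
  obtain C where C: "\<And>x. x \<in> S \<Longrightarrow> norm x \<le> C"
    using compact_imp_bounded[OF \<open>compact S\<close>] by (auto simp: bounded_iff)
  have bound: "norm (h n x) \<le> C" if "x \<in> {0..L}" for n x
    using h(2)[of n] that C by (meson image_subset_iff)
  have equicont: "\<exists>d. 0 < d \<and> (\<forall>n y. y \<in> {0..L} \<and> norm (x - y) < d \<longrightarrow> norm (h n x - h n y) < e)"
    if "x \<in> {0..L}" "0 < e" for x e
  proof (intro exI[of _ e] conjI allI impI)
    fix n y assume y: "y \<in> {0..L} \<and> norm (x - y) < e"
    then have "norm (h n x - h n y) \<le> 1 * norm (x - y)"
      using lipschitz_on_normD[OF h(1)] that(1) by blast
    then show "norm (h n x - h n y) < e" using y by simp
  qed (use that in simp)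
  obtain k and r :: "nat \<Rightarrow> nat" where "strict_mono r"
    and unif: "\<And>e. 0 < e \<Longrightarrow> \<exists>N. \<forall>n x. n \<ge> N \<and> x \<in> {0..L} \<longrightarrow> norm (h (r n) x - k x) < e"
    by (rule Arzela_Ascoli[OF compact_Icc bound equicont]) auto
  have lim_k: "(\<lambda>n. h (r n) x) \<longlonglongrightarrow> k x" if "x \<in> {0..L}" for x
    unfolding LIMSEQ_def dist_norm using unif that by metis
  have "1-lipschitz_on {0..L} k"
  proof (rule lipschitz_onI)
    fix x y assume "x \<in> {0..L}" "y \<in> {0..L}"
    then show "dist (k x) (k y) \<le> 1 * dist x y"
      using lim_k lipschitz_onD[OF h(1)]
      by (intro LIMSEQ_le_const2[OF tendsto_dist[OF lim_k lim_k]]) auto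
  qed simp
  moreover have "k x \<in> S" if "x \<in> {0..L}" for x
    using closed_sequentially[OF compact_imp_closed[OF \<open>compact S\<close>] _ lim_k[OF that]] h(2) that
    by (simp add: image_subset_iff)
  moreover have "k 0 = a"
    using lim_k[of 0] h(3) \<open>0 \<le> L\<close> by (simp add: LIMSEQ_const_iff)
  moreover have "k L = b"
  proof (rule LIMSEQ_unique[OF lim_k])
    show "(\<lambda>n. h (r n) L) \<longlonglongrightarrow> b"
      using LIMSEQ_subseq_LIMSEQ[OF lim \<open>strict_mono r\<close>] by (simp add: h(4) o_def)
  qed (simp add: \<open>0 \<le> L\<close>)
  ultimately show ?thesis
    using \<open>0 \<le> L\<close> unfolding joined_def by blast
qed

lemma joined_obtains_curve:
  assumes "joined S a b L"
  obtains g where "g \<in> curves_joining S a b" "curve_length g \<le> L"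
proof -
  from assms obtain h where h: "1-lipschitz_on {0..L} h" "h ` {0..L} \<subseteq> S" "h 0 = a" "h L = b" "0 \<le> L"
    unfolding joined_def by blast
  define g where "g = (\<lambda>x. h (L * x))"
  have dom: "L * x \<in> {0..L}" if "x \<in> {0..1}" for x
    using that \<open>0 \<le> L\<close> by (auto simp: mult_left_le)
  have lip: "dist (g x) (g y) \<le> L * \<bar>x - y\<bar>" if "x \<in> {0..1}" "y \<in> {0..1}" for x y
    using lipschitz_onD[OF h(1) dom dom, OF that] \<open>0 \<le> L\<close>
    by (simp add: g_def dist_real_def abs_mult flip: right_diff_distrib)
  have "L-lipschitz_on {0..1} g"
    using lip \<open>0 \<le> L\<close> by (auto intro: lipschitz_onI simp: dist_real_def)
  then have "path g"
    by (simp add: path_def lipschitz_on_continuous_on)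
  have sums: "\<sigma> \<le> L" if inscribed: "\<sigma> \<in> inscribed_lengths g" for \<sigma>
  proof -
    obtain n and t :: "nat \<Rightarrow> real" where \<sigma>: "\<sigma> = (\<Sum>i<n. dist (g (t i)) (g (t (Suc i))))"
      and t: "t 0 = 0" "t n = 1" "\<And>i. i < n \<Longrightarrow> t i \<le> t (Suc i)"
      using inscribed unfolding inscribed_lengths_def by auto
    have mono: "t i \<le> t j" if "i \<le> j" "j \<le> n" for i j
      using that
    proof (induction j rule: dec_induct)
      case (step m)
      then show ?case using t(3)[of m] by simp
    qed simp
    have range: "t i \<in> {0..1}" if "i \<le> n" for i
      using mono[of 0 i] mono[of i n] that t(1,2) by simp
    have "\<sigma> \<le> (\<Sum>i<n. L * (t (Suc i) - t i))"
      unfolding \<sigma>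
    proof (rule sum_mono)
      fix i assume "i \<in> {..<n}"
      then show "dist (g (t i)) (g (t (Suc i))) \<le> L * (t (Suc i) - t i)"
        using lip[of "t i" "t (Suc i)"] range[of i] range[of "Suc i"] t(3)[of i] by simp
    qed
    also have "\<dots> = L"
      using t by (simp add: sum_lessThan_telescope flip: sum_distrib_left)
    finally show ?thesis .
  qed
  then have "bdd_above (inscribed_lengths g)" by (rule bdd_aboveI)
  have "dist (g 0) (g 1) \<in> inscribed_lengths g"
    unfolding inscribed_lengths_def
    by (intro CollectI exI[of _ "1::nat"] exI[of _ "\<lambda>i. if i = 0 then 0 else 1 :: real"]) simp
  then have "curve_length g \<le> L"
    unfolding curve_length_def using sums by (intro cSup_least) auto
  moreover have "g \<in> curves_joining S a b"
    unfolding curves_joining_def rectifiable_def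
    using \<open>path g\<close> \<open>bdd_above _\<close> h dom
    by (auto simp: path_image_def pathstart_def pathfinish_def g_def image_subset_iff)
  ultimately show ?thesis using that by blast
qed

lemma joined_zero_iff: "joined S a b 0 \<Longrightarrow> a = b"
  unfolding joined_def by auto

lemma joined_cell_map:
  assumes "joined gasket a b L" "set w \<subseteq> {0,1,2}"
  shows "joined gasket (cell_map w a) (cell_map w b) (L / 2 ^ length w)"
proof -
  let ?N = "2 ^ length w :: real"
  from assms obtain h where h: "1-lipschitz_on {0..L} h" "h ` {0..L} \<subseteq> gasket" "h 0 = a" "h L = b" "0 \<le> L"
    unfolding joined_def by blast
  have dom: "?N * x \<in> {0..L}" if "x \<in> {0..L / ?N}" for x
    using that by (auto simp: field_simps)
  have "1-lipschitz_on {0..L / ?N} (\<lambda>x. cell_map w (h (?N * x)))"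
  proof (rule lipschitz_onI)
    fix x y assume "x \<in> {0..L / ?N}" "y \<in> {0..L / ?N}"
    then have "dist (h (?N * x)) (h (?N * y)) \<le> ?N * dist x y"
      using lipschitz_onD[OF h(1) dom dom, of x y]
      by (simp add: dist_real_def abs_mult flip: right_diff_distrib)
    then show "dist (cell_map w (h (?N * x))) (cell_map w (h (?N * y))) \<le> 1 * dist x y"
      by (simp add: dist_cell_map divide_le_eq mult.commute)
  qed simp
  moreover have "cell_map w (h (?N * x)) \<in> gasket" if "x \<in> {0..L / ?N}" for x
    using h(2) dom[OF that] cell_map_gasket[OF assms(2)] by blast
  ultimately show ?thesis
    unfolding joined_def using h by (intro exI[of _ "\<lambda>x. cell_map w (h (?N * x))"]) auto
qed

text \<open>
  The arc from a corner to \<open>x\<close> follows sides of smaller and smaller cells around \<open>x\<close>.  A step inside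
  the cell at the target corner only rescales; otherwise half a side leads to the next cell.  In both
  cases \<open>1 - bary j x\<close> obeys the same recursion as the length, and the limit of the arcs reaches \<open>x\<close>.
\<close>

lemma joined_corner:
  assumes x: "x \<in> gasket" and j: "j \<in> {0,1,2}"
  shows "joined gasket (corner j) x (1 - bary j x)"
proof -
  obtain C where C: "\<And>x y. \<lbrakk>x \<in> gasket; y \<in> gasket\<rbrakk> \<Longrightarrow> dist x y \<le> C"
    using compact_imp_bounded[OF compact_gasket] by (metis bounded_two_points)
  have approx: "\<exists>y\<in>gasket. joined gasket (corner j) y (1 - bary j x) \<and> dist y x \<le> C / 2 ^ n"
    if "x \<in> gasket" for n x
    using that
  proof (induction n arbitrary: x)
    case 0
    then show ?case
      using C j bary_le_one[of x j] corner_in_gasket[of j]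
      by (intro bexI[of _ "corner j"]) (simp_all add: joined_refl del: insert_iff)
  next
    case (Suc n)
    obtain i x' where i: "i \<in> {0,1,2}" "x' \<in> gasket" "x = sg_map i x'"
      using Suc.prems by (rule gasket_cases)
    obtain y where y: "y \<in> gasket" "joined gasket (corner j) y (1 - bary j x')" "dist y x' \<le> C / 2 ^ n"
      using Suc.IH[OF i(2)] by blast
    have inner: "joined gasket (sg_map i (corner j)) (sg_map i y) ((1 - bary j x') / 2)"
      using joined_cell_map[OF y(2), of "[i]"] i(1) by simp
    have "joined gasket (corner j) (sg_map i y) (1 - bary j x)"
    proof (cases "i = j")
      case True
      then have eq: "1 - bary j x = (1 - bary j x') / 2"
        using bary_sg_map[OF j i(1), of x'] i(3) by (simp add: field_simps)
      show ?thesis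
        using inner[unfolded True sg_map_corner_self] unfolding True eq .
    next
      case False
      have "joined gasket (corner j) (corner i) 1"
        using joined_segment[OF closed_segment_corners_subset_gasket[OF j i(1)]]
          dist_corner[OF j i(1)] False by simp
      from joined_cell_map[OF this, of "[j]"]
      have "joined gasket (corner j) (sg_map i (corner j)) (1 / 2)"
        using j by (simp add: sg_map_corner_commute[of j i])
      then have "joined gasket (corner j) (sg_map i y) (1 / 2 + (1 - bary j x') / 2)"
        using inner by (rule joined_trans)
      moreover have "1 - bary j x = 1 / 2 + (1 - bary j x') / 2"
        using bary_sg_map[OF j i(1), of x'] i(3) False by (simp add: field_simps)
      ultimately show ?thesis by simp
    qed
    moreover have "dist (sg_map i y) x \<le> C / 2 ^ Suc n"
      using y(3) i(3) by (simp add: dist_sg_map field_simps)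
    ultimately show ?case
      using sg_map_gasket[OF i(1) y(1)] by blast
  qed
  have "\<forall>n. \<exists>y. joined gasket (corner j) y (1 - bary j x) \<and> dist y x \<le> C / 2 ^ n"
    using approx[OF x] by blast
  from choice[OF this] obtain y where y: "\<And>n. joined gasket (corner j) (y n) (1 - bary j x)"
      "\<And>n. dist (y n) x \<le> C / 2 ^ n"
    by blast
  have "(\<lambda>n. dist (y n) x) \<longlonglongrightarrow> 0"
  proof (rule tendsto_sandwich[OF _ _ tendsto_const])
    show "(\<lambda>n. C / 2 ^ n) \<longlonglongrightarrow> 0"
      by (intro LIMSEQ_divide_realpow_zero) simp
  qed (use y(2) in auto)
  then have "y \<longlonglongrightarrow> x" by (rule tendsto_dist_iff[THEN iffD2])
  with compact_gasket y(1) show ?thesis by (rule joined_limit)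
qed

section \<open>Lengths of curves, bounded from below\<close>

text \<open>
  The lengths of polygons inscribed in the part of a curve over \<open>{s..t}\<close>, built up one chord at a
  time: appending and reversing partitions becomes rule induction.
\<close>

inductive inscribed :: "(real \<Rightarrow> 'a::metric_space) \<Rightarrow> real \<Rightarrow> real \<Rightarrow> real \<Rightarrow> bool" for g where
  inscribed_empty: "inscribed g s s 0"
| inscribed_step: "\<lbrakk>s \<le> r; inscribed g r t \<sigma>\<rbrakk> \<Longrightarrow> inscribed g s t (dist (g s) (g r) + \<sigma>)"

lemma inscribed_single: "s \<le> t \<Longrightarrow> inscribed g s t (dist (g s) (g t))"
  using inscribed_step[OF _ inscribed_empty[of g t]] by simp

lemma inscribed_append:
  "\<lbrakk>inscribed g s r \<sigma>; inscribed g r t \<tau>\<rbrakk> \<Longrightarrow> inscribed g s t (\<sigma> + \<tau>)"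
  by (induction rule: inscribed.induct) (auto simp: add.assoc intro: inscribed_step)

lemma inscribed_reverse:
  "inscribed g s t \<sigma> \<Longrightarrow> inscribed (\<lambda>r. g (- r)) (- t) (- s) \<sigma>"
proof (induction rule: inscribed.induct)
  case (inscribed_step s r t \<sigma>)
  have "inscribed (\<lambda>r. g (- r)) (- r) (- s) (dist (g s) (g r))"
    using inscribed_single[of "- r" "- s" "\<lambda>r. g (- r)"] inscribed_step.hyps
    by (simp add: dist_commute)
  with inscribed_step.IH show ?case
    using inscribed_append by (subst add.commute) blast
qed (rule inscribed_empty)

lemma inscribed_imp_partition:
  assumes "inscribed g s t \<sigma>"
  shows "\<exists>(n::nat) p. p 0 = s \<and> p n = t \<and> (\<forall>i<n. p i \<le> p (Suc i))
    \<and> \<sigma> = (\<Sum>i<n. dist (g (p i)) (g (p (Suc i))))"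
  using assms
proof (induction rule: inscribed.induct)
  case (inscribed_empty s)
  show ?case by (intro exI[of _ "0::nat"] exI[of _ "\<lambda>_. s"]) simp
next
  case (inscribed_step s r t \<sigma>)
  then obtain n :: nat and p where p: "p 0 = r" "p n = t" "\<And>i. i < n \<Longrightarrow> p i \<le> p (Suc i)"
    "\<sigma> = (\<Sum>i<n. dist (g (p i)) (g (p (Suc i))))" by blast
  have "case_nat s p i \<le> case_nat s p (Suc i)" if "i < Suc n" for i
    using that p(1,3) inscribed_step.hyps(1) by (cases i) auto
  then show ?case
    using p by (intro exI[of _ "Suc n"] exI[of _ "case_nat s p"])
      (simp add: sum.lessThan_Suc_shift del: sum.lessThan_Suc)
qed

text \<open>
  The length enters only through the upper bounds \<open>L\<close> of all inscribed polygons.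
\<close>

definition gasket_curve :: "(real \<Rightarrow> real \<times> real) \<Rightarrow> real \<Rightarrow> real \<Rightarrow> real \<Rightarrow> bool" where
  "gasket_curve g s t L \<longleftrightarrow> s \<le> t \<and> continuous_on {s..t} g \<and> g ` {s..t} \<subseteq> gasket
     \<and> (\<forall>\<sigma>. inscribed g s t \<sigma> \<longrightarrow> \<sigma> \<le> L)"

lemma curves_joining_imp_gasket_curve:
  assumes "g \<in> curves_joining gasket a b" shows "gasket_curve g 0 1 (curve_length g)"
proof -
  have bdd: "bdd_above (inscribed_lengths g)"
    using assms by (auto simp: curves_joining_def rectifiable_def)
  have "\<sigma> \<in> inscribed_lengths g" if "inscribed g 0 1 \<sigma>" for \<sigma>
    using inscribed_imp_partition[OF that] unfolding inscribed_lengths_def by blast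
  then show ?thesis
    using assms cSup_upper[OF _ bdd]
    by (auto simp: gasket_curve_def curve_length_def curves_joining_def rectifiable_def
        path_def path_image_def)
qed

lemma gasket_curve_dist_le: "gasket_curve g s t L \<Longrightarrow> dist (g s) (g t) \<le> L"
  unfolding gasket_curve_def using inscribed_single by blast

text \<open>
  Superadditivity of length in the form in which it is used: a lower bound \<open>V\<close> for every upper bound
  of one part of the curve is subtracted from the upper bound of the whole.  No supremum appears.
\<close>

lemma gasket_curve_drop_end:
  assumes g: "gasket_curve g s u L" and t: "t \<in> {s..u}"
    and V: "\<And>L'. gasket_curve g t u L' \<Longrightarrow> V \<le> L'"
  shows "gasket_curve g s t (L - V)"
proof -
  have sub: "{s..t} \<subseteq> {s..u}" "{t..u} \<subseteq> {s..u}" using t by auto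
  have "\<sigma> \<le> L - V" if "inscribed g s t \<sigma>" for \<sigma>
  proof -
    have "\<forall>\<tau>. inscribed g t u \<tau> \<longrightarrow> \<tau> \<le> L - \<sigma>"
      using g inscribed_append[OF that] unfolding gasket_curve_def by (metis le_diff_eq add.commute)
    then have "gasket_curve g t u (L - \<sigma>)"
      using g t sub continuous_on_subset unfolding gasket_curve_def by fastforce
    then show ?thesis using V by fastforce
  qed
  then show ?thesis
    using g t sub continuous_on_subset unfolding gasket_curve_def by fastforce
qed

lemma gasket_curve_reverse:
  assumes "gasket_curve g s t L" shows "gasket_curve (\<lambda>r. g (- r)) (- t) (- s) L"
proof -
  have cont: "continuous_on {s..t} g" using assms by (simp add: gasket_curve_def)
  have "continuous_on {- t..- s} (\<lambda>r. g (- r))"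
    by (rule continuous_on_compose2[OF cont]) (auto intro: continuous_intros)
  moreover have "inscribed g s t \<sigma>" if "inscribed (\<lambda>r. g (- r)) (- t) (- s) \<sigma>" for \<sigma>
    using inscribed_reverse[OF that] by simp
  ultimately show ?thesis
    using assms unfolding gasket_curve_def by (auto simp: image_subset_iff)
qed

lemma gasket_curve_drop_start:
  assumes g: "gasket_curve g s u L" and t: "t \<in> {s..u}"
    and V: "\<And>L'. gasket_curve g s t L' \<Longrightarrow> V \<le> L'"
  shows "gasket_curve g t u (L - V)"
proof -
  have "gasket_curve (\<lambda>r. g (- r)) (- u) (- t) (L - V)"
  proof (rule gasket_curve_drop_end[OF gasket_curve_reverse[OF g]])
    fix L' assume "gasket_curve (\<lambda>r. g (- r)) (- t) (- s) L'"
    from gasket_curve_reverse[OF this] show "V \<le> L'" by (intro V) simp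
  qed (use t in auto)
  from gasket_curve_reverse[OF this] show ?thesis by simp
qed

section \<open>Cells are left through their corners\<close>

text \<open>
  The witness consists of the siblings of the cell and of all larger cells around it.  A sibling
  meets the cell in one midpoint of a side of the parent, which is a corner of the cell; a sibling
  of a larger cell meets it at most in a corner inherited from the parent.
\<close>

lemma cell_exterior:
  assumes "set w \<subseteq> {0,1,2}"
  shows "\<exists>E. closed E \<and> gasket = cell_map w ` gasket \<union> E
    \<and> cell_map w ` gasket \<inter> E \<subseteq> cell_map w ` corner ` {0,1,2}"
  using assms
proof (induction w rule: rev_induct)
  case Nil
  show ?case by (intro exI[of _ "{}"]) simp
next
  case (snoc i w)
  let ?F = "cell_map w"
  let ?cell = "\<lambda>k. ?F ` sg_map k ` gasket"
  have w: "set w \<subseteq> {0,1,2}" and i: "i \<in> {0,1,2}" using snoc.prems by auto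
  obtain E where E: "closed E" "gasket = ?F ` gasket \<union> E"
    "?F ` gasket \<inter> E \<subseteq> ?F ` corner ` {0,1,2}"
    using snoc.IH[OF w] by blast
  define E' where "E' = E \<union> (\<Union>k\<in>{0,1,2} - {i}. ?cell k)"
  have closed_cell: "closed (?cell k)" for k
    by (intro compact_imp_closed compact_continuous_image continuous_on_cell_map
        continuous_on_sg_map compact_gasket)
  have "closed E'"
    unfolding E'_def using E(1) closed_cell by (intro closed_Un closed_UN) auto
  moreover have "gasket = ?cell i \<union> E'"
  proof -
    have letters: "insert i ({0,1,2} - {i}) = {0,1,2}"
      using i by (rule insert_Diff)
    have "?F ` gasket = (\<Union>k\<in>{0,1,2}. ?cell k)"
      by (subst gasket_eq) (rule image_UN)
    also have "\<dots> = ?cell i \<union> (\<Union>k\<in>{0,1,2} - {i}. ?cell k)"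
      using UN_insert[of ?cell i "{0,1,2} - {i}"] unfolding letters .
    finally have split: "?F ` gasket = ?cell i \<union> (\<Union>k\<in>{0,1,2} - {i}. ?cell k)" .
    show ?thesis
      by (rule trans[OF E(2)]) (simp only: split E'_def Un_ac)
  qed
  moreover have "?cell i \<inter> E' \<subseteq> cell_map (w @ [i]) ` corner ` {0,1,2}"
  proof
    fix z assume z: "z \<in> ?cell i \<inter> E'"
    then obtain x where x: "x \<in> sg_map i ` gasket" "z = ?F x" by blast
    have "\<exists>m\<in>{0,1,2}. x = sg_map i (corner m)"
    proof (cases "z \<in> E")
      case True
      have "x \<in> gasket" using x i sg_map_gasket by blast
      then have "?F x \<in> ?F ` gasket \<inter> E"
        using True x(2) by simp
      then have "x \<in> corner ` {0,1,2}"
        using subsetD[OF E(3)] cell_map_mem_image_iff by metis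
      then obtain m where m: "x = corner m" "m \<in> {0,1,2}"
        by (rule imageE)
      then have "m = i"
        using corner_notin_subtriangle[OF i m(2)] x(1) by metis
      then have "x = sg_map i (corner m)" using m(1) by simp
      then show ?thesis using m(2) by (rule bexI)
    next
      case False
      then have "z \<in> (\<Union>k\<in>{0,1,2} - {i}. ?cell k)"
        using z unfolding E'_def by (metis IntD2 UnE)
      then obtain k where k: "k \<in> {0,1,2} - {i}" "z \<in> ?cell k"
        by (rule UN_E)
      then have k': "k \<in> {0,1,2}" "i \<noteq> k" by simp_all
      have "x \<in> sg_map k ` gasket"
        using k(2) x(2) by simp
      then have "x = sg_map i (corner k)"
        using subtriangles_meet[OF x(1) _ i k'] by blast
      then show ?thesis using k'(1) by (rule bexI)
    qed
    then show "z \<in> cell_map (w @ [i]) ` corner ` {0,1,2}"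
      using x(2) by auto
  qed
  ultimately show ?case
    by (intro exI[of _ E']) (simp add: image_image)
qed

lemma curve_crosses_closed_cover:
  fixes g :: "real \<Rightarrow> 'a::topological_space"
  assumes cont: "continuous_on {s..t} g" "s \<le> t" and "closed U" "closed E"
    and cover: "g ` {s..t} \<subseteq> U \<union> E" and ends: "g s \<in> U" "g t \<in> E"
  obtains r where "r \<in> {s..t}" "g r \<in> U \<inter> E"
proof -
  have "connected (g ` {s..t})"
    by (rule connected_continuous_image[OF cont(1) connected_Icc])
  moreover have "U \<inter> g ` {s..t} \<noteq> {}" "E \<inter> g ` {s..t} \<noteq> {}"
    using ends \<open>s \<le> t\<close> by auto
  ultimately have "U \<inter> E \<inter> g ` {s..t} \<noteq> {}"
    using connected_closedD[OF _ _ cover \<open>closed U\<close> \<open>closed E\<close>] by blast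
  then show ?thesis using that by blast
qed

lemma closed_gasket_image: "closed (cell_map w ` gasket)"
  by (intro compact_imp_closed compact_continuous_image continuous_on_cell_map compact_gasket)

lemma curve_leaves_cell_through_corner:
  assumes g: "gasket_curve g s t L" and w: "set w \<subseteq> {0,1,2}"
    and start: "g s \<in> cell_map w ` gasket"
    and finish: "g t \<in> cell_map w ` gasket \<Longrightarrow> g t \<in> cell_map w ` corner ` {0,1,2}"
  obtains r m where "r \<in> {s..t}" "m \<in> {0,1,2}" "g r = cell_map w (corner m)"
proof (cases "g t \<in> cell_map w ` gasket")
  case True
  then obtain m where "m \<in> {0,1,2}" "g t = cell_map w (corner m)"
    using finish[OF True] by (elim imageE) metis
  moreover have "t \<in> {s..t}" using g by (simp add: gasket_curve_def)
  ultimately show ?thesis using that by blast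
next
  case False
  obtain E where E: "closed E" "gasket = cell_map w ` gasket \<union> E"
    "cell_map w ` gasket \<inter> E \<subseteq> cell_map w ` corner ` {0,1,2}"
    using cell_exterior[OF w] by blast
  have c: "continuous_on {s..t} g" "s \<le> t" "g ` {s..t} \<subseteq> gasket"
    using g by (simp_all add: gasket_curve_def)
  then have "g t \<in> gasket" by auto
  then have "g t \<in> E" using False E(2) by (metis UnE)
  have cover: "g ` {s..t} \<subseteq> cell_map w ` gasket \<union> E"
    using c(3) E(2) by (rule order_trans[OF _ equalityD1])
  obtain r where r: "r \<in> {s..t}" "g r \<in> cell_map w ` gasket \<inter> E"
    using curve_crosses_closed_cover[OF c(1,2) closed_gasket_image E(1) cover start \<open>g t \<in> E\<close>] .
  have "g r \<in> cell_map w ` corner ` {0,1,2}" using E(3) r(2) by (rule subsetD)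
  then show ?thesis using that[OF r(1)] by (elim imageE) metis
qed

text \<open>
  The junction of the subcells \<open>i\<close> and \<open>l\<close> is an interior point of their union.  The union therefore has
  at most four boundary points, each half a side away from that junction, and a curve to the corner
  \<open>j\<close> has to pass one of them.
\<close>

lemma curve_leaves_two_subcells:
  assumes g: "gasket_curve g s t L" and w: "set w \<subseteq> {0,1,2}"
    and ijl: "i \<in> {0,1,2}" "j \<in> {0,1,2}" "l \<in> {0,1,2}" "i \<noteq> j" "l \<noteq> j" "{0,1,2} = {i, j, l}"
    and start: "g s \<in> cell_map w ` sg_map i ` gasket" and finish: "g t = cell_map w (corner j)"
  obtains r y where "r \<in> {s..t}" "g r = cell_map w y"
    "y \<in> {corner i, corner l, sg_map i (corner j), sg_map l (corner j)}"
proof -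
  let ?F = "cell_map w"
  let ?cell = "\<lambda>k. ?F ` sg_map k ` gasket"
  obtain E where E: "closed E" "gasket = ?F ` gasket \<union> E"
    "?F ` gasket \<inter> E \<subseteq> ?F ` corner ` {0,1,2}"
    using cell_exterior[OF w] by blast
  have closed_cell: "closed (?cell k)" for k
    using closed_gasket_image[of "w @ [k]"] by (simp add: image_comp comp_def)
  have "?F ` gasket = (\<Union>k\<in>{0,1,2}. ?cell k)"
    by (subst gasket_eq) (rule image_UN)
  also have "\<dots> = ?cell i \<union> ?cell j \<union> ?cell l"
    unfolding ijl(6) by (simp only: UN_insert UN_empty Un_empty_right Un_assoc)
  finally have split: "?F ` gasket = ?cell i \<union> ?cell j \<union> ?cell l" .
  let ?U = "?cell i \<union> ?cell l" and ?E = "E \<union> ?cell j"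
  have c: "continuous_on {s..t} g" "s \<le> t" "g ` {s..t} \<subseteq> gasket"
    using g by (simp_all add: gasket_curve_def)
  have "gasket \<subseteq> ?U \<union> ?E"
    using E(2) split by auto
  with c(3) have cover: "g ` {s..t} \<subseteq> ?U \<union> ?E" by (rule order_trans)
  have "closed ?U" "closed ?E"
    using closed_cell E(1) by (auto intro!: closed_Un)
  moreover have "g s \<in> ?U" using start by blast
  moreover have "corner j \<in> sg_map j ` gasket"
    using corner_in_gasket[OF ijl(2)] by (metis image_eqI sg_map_corner_self)
  then have "g t \<in> ?E" using finish by blast
  ultimately obtain r where r: "r \<in> {s..t}" "g r \<in> ?U \<inter> ?E"
    using curve_crosses_closed_cover[OF c(1,2) _ _ cover] by metis
  then obtain k y where k: "k \<in> {i, l}" and y: "y \<in> sg_map k ` gasket" "g r = ?F y" by blast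
  then have "k \<in> {0,1,2}" "k \<noteq> j" using ijl by auto
  show ?thesis
  proof (cases "g r \<in> E")
    case True
    have "y \<in> gasket" using y(1) \<open>k \<in> {0,1,2}\<close> sg_map_gasket by blast
    then have "?F y \<in> ?F ` gasket \<inter> E"
      using True y(2) by simp
    then have "y \<in> corner ` {0,1,2}"
      using subsetD[OF E(3)] cell_map_mem_image_iff by metis
    then obtain m where m: "y = corner m" "m \<in> {0,1,2}"
      by (rule imageE)
    have "m = k"
      using corner_notin_subtriangle[OF \<open>k \<in> {0,1,2}\<close> m(2)] y(1) m(1) by metis
    then show ?thesis using that[OF r(1) y(2)] m k by auto
  next
    case False
    then have "?F y \<in> ?cell j" using r(2) y(2) by auto
    then have "y \<in> sg_map j ` gasket" by simp
    then have "y = sg_map k (corner j)"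
      using subtriangles_meet[OF y(1) _ \<open>k \<in> {0,1,2}\<close> ijl(2) \<open>k \<noteq> j\<close>] by blast
    then show ?thesis using that[OF r(1) y(2)] k by auto
  qed
qed

section \<open>Lower bounds for lengths in the gasket\<close>

lemma dist_midpoint:
  assumes "i \<in> {0,1,2}" "j \<in> {0,1,2}" "i \<noteq> j"
  shows "dist (sg_map i (corner j)) (corner i) = 1 / 2"
    and "dist (sg_map i (corner j)) (corner j) = 1 / 2"
  using dist_sg_map[of i "corner j" "corner i"] dist_sg_map[of j "corner i" "corner j"]
    dist_corner[OF assms] by (simp_all add: dist_commute sg_map_corner_commute[of j i])

lemma dist_midpoint_midpoint:
  assumes "j \<in> {0,1,2}" "l \<in> {0,1,2}" "j \<noteq> l"
  shows "dist (sg_map i (corner j)) (sg_map i (corner l)) = 1 / 2"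
  using dist_corner[OF assms] by (simp add: dist_sg_map)

lemma gasket_curve_nonneg: "gasket_curve g s t L \<Longrightarrow> 0 \<le> L"
  using gasket_curve_dist_le by (meson order_trans zero_le_dist)

lemma gasket_curve_drop_end_dist:
  assumes "gasket_curve g s u L" "t \<in> {s..u}"
  shows "gasket_curve g s t (L - dist (g t) (g u))"
  using assms by (rule gasket_curve_drop_end) (rule gasket_curve_dist_le)

lemma gasket_curve_dist_add_le:
  assumes "gasket_curve g s u L" "t \<in> {s..u}"
  shows "dist (g s) (g t) + dist (g t) (g u) \<le> L"
  using gasket_curve_dist_le[OF gasket_curve_drop_end_dist[OF assms]] by simp

text \<open>
  The error term makes the bound trivial at the start of the induction, and each further level halves
  it; if \<open>x\<close> lies in the subcell at the corner \<open>j\<close>, this is only a change of scale.  Now let \<open>x\<close> lie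
  in the subcell \<open>i\<close>, with \<open>i \<noteq> j\<close>.  The curve leaves this subcell through one of its corners: through the outer corner \<open>i\<close>, a full side away from the corner \<open>j\<close>; through
  the junction with the subcell \<open>j\<close>, where the induction hypothesis for the smaller cell applies and
  half a side remains; or through the third corner, the junction with the subcell \<open>l\<close>, from which two
  further half sides are unavoidable.  The chord from that last junction to the corner \<open>j\<close> is too short,
  so the second exit point is essential there.
\<close>

lemma corner_distance_lower_approx:
  assumes "set v \<subseteq> {0,1,2}" "j \<in> {0,1,2}" "x \<in> gasket" "gasket_curve g s t L"
    "g s = cell_map v x" "g t = cell_map v (corner j)"
  shows "(1 - bary j x - 1 / 2 ^ n) / 2 ^ length v \<le> L"
  using assms
proof (induction n arbitrary: v x t L)
  case 0
  have "(1 - bary j x - 1 / 2 ^ 0) / 2 ^ length v \<le> 0"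
    using bary_nonneg[OF 0(3,2)] by (simp add: divide_le_0_iff)
  also have "0 \<le> L" using gasket_curve_nonneg[OF 0(4)] .
  finally show ?case .
next
  case (Suc n)
  let ?N = "2 ^ length v :: real"
  note v = Suc.prems(1) and j = Suc.prems(2) and x = Suc.prems(3) and g = Suc.prems(4)
    and start = Suc.prems(5) and finish = Suc.prems(6)
  obtain i x' where i: "i \<in> {0,1,2}" "x' \<in> gasket" "x = sg_map i x'"
    using x by (rule gasket_cases)
  have vi: "set (v @ [i]) \<subseteq> {0,1,2}" using v i(1) by simp
  have start': "g s = cell_map (v @ [i]) x'" using start i(3) by simp
  have bary_x: "bary j x = (bary j x' + (if j = i then 1 else 0)) / 2"
    unfolding i(3) by (rule bary_sg_map[OF j i(1)])
  show ?case
  proof (cases "i = j")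
    case True
    have "(1 - bary j x' - 1 / 2 ^ n) / 2 ^ length (v @ [i]) \<le> L"
      using Suc.IH[OF vi j i(2) g start'] finish True by simp
    moreover have eq: "1 - bary j x - 1 / 2 ^ Suc n = (1 - bary j x' - 1 / 2 ^ n) / 2"
      using True by (simp add: bary_x diff_divide_distrib add_divide_distrib)
    ultimately show ?thesis
      unfolding eq by (simp add: mult.commute)
  next
    case False
    obtain l where l: "l \<in> {0,1,2}" "l \<noteq> i" "l \<noteq> j" "{0,1,2} = {i, j, l}"
      using third_letter[OF i(1) j False] .
    \<comment> \<open>The side of the cell dominates the claimed bound for every \<open>x\<close>.\<close>
    have long: ?thesis if "1 / ?N \<le> L"
    proof -
      have "(1 - bary j x - 1 / 2 ^ Suc n) / ?N \<le> 1 / ?N"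
      proof (rule divide_right_mono)
        have "(0::real) \<le> 1 / 2 ^ Suc n" by simp
        then show "1 - bary j x - 1 / 2 ^ Suc n \<le> 1"
          using bary_nonneg[OF x j] by linarith
      qed simp
      then show ?thesis using that by (rule order_trans)
    qed
    have "g s \<in> cell_map (v @ [i]) ` gasket"
      unfolding start' using i(2) by (rule imageI)
    moreover have "g t \<notin> cell_map (v @ [i]) ` gasket"
    proof
      assume "g t \<in> cell_map (v @ [i]) ` gasket"
      then have "cell_map v (corner j) \<in> cell_map v ` sg_map i ` gasket"
        unfolding finish by (simp add: image_comp comp_def)
      then show False
        using corner_notin_subtriangle[OF i(1) j False] by simp
    qed
    ultimately obtain r m where r: "r \<in> {s..t}" and m: "m \<in> {0,1,2}"
      and gr: "g r = cell_map (v @ [i]) (corner m)"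
      using curve_leaves_cell_through_corner[OF g vi] by metis
    have dist_rt: "dist (g r) (g t) = dist (sg_map i (corner m)) (corner j) / ?N"
      unfolding gr finish by (simp add: dist_cell_map)
    from m consider "m = i" | "m = j" | "m = l" unfolding l(4) by blast
    then show ?thesis
    proof cases
      case 1
      then have "dist (g r) (g t) = 1 / ?N"
        using dist_rt dist_corner[OF i(1) j False] by simp
      then show ?thesis
        using gasket_curve_dist_add_le[OF g r] zero_le_dist[of "g s" "g r"] by (intro long) linarith
    next
      case 2
      have "dist (g r) (g t) = 1 / 2 / ?N"
        using dist_rt dist_midpoint[OF i(1) j False] 2 by simp
      then have "gasket_curve g s r (L - 1 / 2 / ?N)"
        using gasket_curve_drop_end_dist[OF g r] by simp
      from Suc.IH[OF vi j i(2) this start'] gr 2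
      have "(1 - bary j x' - 1 / 2 ^ n) / 2 ^ length (v @ [i]) \<le> L - 1 / 2 / ?N"
        by simp
      then have "(1 - bary j x' - 1 / 2 ^ n) / 2 / ?N + 1 / 2 / ?N \<le> L"
        by (simp add: mult.commute)
      moreover have "1 - bary j x - 1 / 2 ^ Suc n = (1 - bary j x' - 1 / 2 ^ n) / 2 + 1 / 2"
        using bary_x False by (simp add: field_simps)
      ultimately show ?thesis
        by (simp only: add_divide_distrib)
    next
      case 3
      have g': "gasket_curve g r t L"
        using gasket_curve_drop_start[OF g r gasket_curve_nonneg] by simp
      have "corner l \<in> gasket" using corner_in_gasket[OF l(1)] .
      then have gr': "g r \<in> cell_map v ` sg_map i ` gasket"
        using gr 3 by simp
      obtain r' y where r': "r' \<in> {r..t}" and y: "g r' = cell_map v y"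
        "y \<in> {corner i, corner l, sg_map i (corner j), sg_map l (corner j)}"
        using curve_leaves_two_subcells[OF g' v i(1) j l(1) False l(3,4) gr' finish] .
      have neq: "i \<noteq> l" "j \<noteq> l" "j \<noteq> i" using l False by auto
      have "1 / 2 \<le> dist (sg_map i (corner l)) y"
        using y(2) dist_midpoint[OF i(1) l(1) neq(1)] dist_midpoint_midpoint[OF l(1) j l(3)]
          dist_midpoint_midpoint[OF i(1) j False, of l, unfolded sg_map_corner_commute[of l i]]
        by auto
      moreover have "1 / 2 \<le> dist y (corner j)"
        using y(2) dist_corner[OF i(1) j False] dist_corner[OF l(1) j l(3)]
          dist_midpoint[OF i(1) j False] dist_midpoint[OF l(1) j l(3)] by auto
      ultimately have "1 / 2 / ?N + 1 / 2 / ?N \<le>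
          dist (sg_map i (corner l)) y / ?N + dist y (corner j) / ?N"
        by (intro add_mono divide_right_mono) simp_all
      also have "\<dots> = dist (g r) (g r') + dist (g r') (g t)"
        using 3 unfolding gr finish y(1) by (simp add: dist_cell_map)
      also have "\<dots> \<le> L"
        using gasket_curve_dist_add_le[OF g' r'] .
      finally have "1 / ?N \<le> L" by (simp add: field_simps)
      then show ?thesis by (rule long)
    qed
  qed
qed

lemma corner_distance_lower:
  assumes "set v \<subseteq> {0,1,2}" "j \<in> {0,1,2}" "x \<in> gasket" "gasket_curve g s t L"
    "g s = cell_map v x" "g t = cell_map v (corner j)"
  shows "(1 - bary j x) / 2 ^ length v \<le> L"
proof (rule LIMSEQ_le_const2)
  have "(\<lambda>n. 1 / 2 ^ n :: real) \<longlonglongrightarrow> 0"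
    by (intro LIMSEQ_divide_realpow_zero) simp
  then have "(\<lambda>n. (1 - bary j x - 1 / 2 ^ n) / 2 ^ length v) \<longlonglongrightarrow> (1 - bary j x - 0) / 2 ^ length v"
    by (intro tendsto_intros) auto
  then show "(\<lambda>n. (1 - bary j x - 1 / 2 ^ n) / 2 ^ length v) \<longlonglongrightarrow> (1 - bary j x) / 2 ^ length v"
    by simp
  show "\<exists>N. \<forall>n\<ge>N. (1 - bary j x - 1 / 2 ^ n) / 2 ^ length v \<le> L"
    using corner_distance_lower_approx[OF assms] by blast
qed

lemma corner_distance_lower_reversed:
  assumes "set v \<subseteq> {0,1,2}" "j \<in> {0,1,2}" "x \<in> gasket" "gasket_curve g s t L"
    "g s = cell_map v (corner j)" "g t = cell_map v x"
  shows "(1 - bary j x) / 2 ^ length v \<le> L"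
  using corner_distance_lower[OF assms(1-3) gasket_curve_reverse[OF assms(4)]] assms(5,6) by simp

text \<open>
  A curve from the subcell \<open>i\<close> to the subcell \<open>j\<close> passes a corner of \<open>i\<close> and later one of \<open>j\<close>.  If one of
  them is the common junction, the two corner distances give the first alternative of the minimum; if
  both are junctions with the third subcell \<open>l\<close>, they give the second, with the side between them as the
  additional term.  A detour over an outer corner never pays, and this includes curves that leave the
  whole cell: the outer corner is a corner of the big cell too, so the corner bound applies to it at the
  larger scale and is at least the first alternative.
\<close>

lemma adjacent_cells_distance_lower:
  assumes w: "set w \<subseteq> {0,1,2}" and ij: "i \<in> {0,1,2}" "j \<in> {0,1,2}" "i \<noteq> j"
    and l: "l \<in> {0,1,2}" "l \<noteq> i" "l \<noteq> j" "{0,1,2} = {i, j, l}"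
    and x: "x \<in> gasket" and y: "y \<in> gasket" and g: "gasket_curve g s t L"
    and start: "g s = cell_map w (sg_map i x)" and finish: "g t = cell_map w (sg_map j y)"
  shows "min (1 - bary j x + (1 - bary i y)) (1 + (1 - bary l x) + (1 - bary l y))
    / 2 ^ Suc (length w) \<le> L"
proof -
  let ?N = "2 ^ Suc (length w) :: real"
  have wi: "set (w @ [i]) \<subseteq> {0,1,2}" and wj: "set (w @ [j]) \<subseteq> {0,1,2}"
    using w ij by simp_all
  have start': "g s = cell_map (w @ [i]) x" and finish': "g t = cell_map (w @ [j]) y"
    using start finish by simp_all
  have xi: "sg_map i x \<in> gasket" and yj: "sg_map j y \<in> gasket"
    using sg_map_gasket x y ij by blast+
  have direct: ?thesis if "(1 - bary j x + (1 - bary i y)) / ?N \<le> L"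
    by (rule order_trans[OF divide_right_mono that]) auto
  have detour: ?thesis if "(1 + (1 - bary l x) + (1 - bary l y)) / ?N \<le> L"
    by (rule order_trans[OF divide_right_mono that]) auto
  \<comment> \<open>The point at time \<open>r\<close> is a corner of both small cells.\<close>
  have junction: ?thesis if r: "r \<in> {s..t}" "g r = cell_map w (sg_map i (corner j))" for r
  proof -
    have "(1 - bary i y) / ?N \<le> L'" if "gasket_curve g r t L'" for L'
      using corner_distance_lower_reversed[OF wj ij(1) y that _ finish'] r(2)
      by (simp add: sg_map_corner_commute[of j i])
    from corner_distance_lower[OF wi ij(2) x gasket_curve_drop_end[OF g r(1) this] start'] r(2)
    have "(1 - bary j x) / ?N \<le> L - (1 - bary i y) / ?N" by simp
    then have "(1 - bary j x) / ?N + (1 - bary i y) / ?N \<le> L" by linarith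
    then show ?thesis
      by (intro direct) (simp only: add_divide_distrib)
  qed
  \<comment> \<open>Here the corner bound is applied to the big cell \<open>w\<close> instead of \<open>w @ [j]\<close>.\<close>
  have outer_i: ?thesis if r: "r \<in> {s..t}" "g r = cell_map w (corner i)" for r
  proof -
    have "gasket_curve g r t L"
      using gasket_curve_drop_start[OF g r(1) gasket_curve_nonneg] by simp
    from corner_distance_lower_reversed[OF w ij(1) yj this r(2) finish]
    have "(1 - bary i y / 2) / 2 ^ length w \<le> L"
      using bary_sg_map[OF ij(1,2), of y] ij(3) by simp
    then have "(1 + (1 - bary i y)) / ?N \<le> L"
      by (simp add: field_simps)
    moreover have "(1 - bary j x + (1 - bary i y)) / ?N \<le> (1 + (1 - bary i y)) / ?N"
      using bary_nonneg[OF x ij(2)] by (intro divide_right_mono) auto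
    ultimately show ?thesis by (intro direct) simp
  qed
  have outer_j: ?thesis if r: "r \<in> {s..t}" "g r = cell_map w (corner j)" for r
  proof -
    have "gasket_curve g s r L"
      using gasket_curve_drop_end[OF g r(1) gasket_curve_nonneg] by simp
    from corner_distance_lower[OF w ij(2) xi this start r(2)]
    have "(1 - bary j x / 2) / 2 ^ length w \<le> L"
      using bary_sg_map[OF ij(2,1), of x] ij(3) by simp
    then have "(1 + (1 - bary j x)) / ?N \<le> L"
      by (simp add: field_simps)
    moreover have "(1 - bary j x + (1 - bary i y)) / ?N \<le> (1 + (1 - bary j x)) / ?N"
      using bary_nonneg[OF y ij(1)] by (intro divide_right_mono) auto
    ultimately show ?thesis by (intro direct) simp
  qed
  have cell: "cell_map (w @ [k]) ` gasket = cell_map w ` sg_map k ` gasket" for k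
    by (simp add: image_comp comp_def)
  have x_in: "g s \<in> cell_map (w @ [i]) ` gasket" unfolding start' using x by (rule imageI)
  have y_in: "g t \<in> cell_map (w @ [j]) ` gasket" unfolding finish' using y by (rule imageI)
  have y_corner: "g t \<in> cell_map (w @ [i]) ` corner ` {0,1,2}" if "g t \<in> cell_map (w @ [i]) ` gasket"
  proof -
    have "sg_map j y \<in> sg_map i ` gasket"
      using that unfolding cell finish by simp
    then have "sg_map j y = sg_map i (corner j)"
      using subtriangles_meet[OF _ imageI[OF y] ij] by blast
    then have "g t = cell_map (w @ [i]) (corner j)" using finish by simp
    then show ?thesis using ij(2) by (metis image_eqI)
  qed
  obtain r m where r: "r \<in> {s..t}" and m: "m \<in> {0,1,2}" and gr: "g r = cell_map (w @ [i]) (corner m)"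
    using curve_leaves_cell_through_corner[OF g wi x_in y_corner] .
  from m consider "m = i" | "m = j" | "m = l" unfolding l(4) by blast
  then show ?thesis
  proof cases
    case 1
    then show ?thesis using outer_i[OF r] gr by simp
  next
    case 2
    then show ?thesis using junction[OF r] gr by simp
  next
    case 3
    \<comment> \<open>The reversed curve leaves the cell of \<open>y\<close>: this yields a corner of that cell after time \<open>r\<close>.\<close>
    have g': "gasket_curve (\<lambda>u. g (- u)) (- t) (- r) L"
      using gasket_curve_reverse[OF gasket_curve_drop_start[OF g r gasket_curve_nonneg]] by simp
    have gr_l: "g r = cell_map w (sg_map i (corner l))" using gr 3 by simp
    have "g r \<in> cell_map (w @ [j]) ` corner ` {0,1,2}" if "g r \<in> cell_map (w @ [j]) ` gasket"
    proof -
      have "sg_map i (corner l) \<in> sg_map j ` gasket"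
        using that unfolding cell gr_l by simp
      then have "sg_map i (corner l) = sg_map i (corner j)"
        using subtriangles_meet[OF imageI[OF corner_in_gasket[OF l(1)]] _ ij] by blast
      then show ?thesis
        using bary_corner[OF l(1) l(1)] bary_corner[OF l(1) ij(2)] l(3) by simp
    qed
    then obtain r' m' where r': "r' \<in> {- t..- r}" and m': "m' \<in> {0,1,2}"
      and gr': "g (- r') = cell_map (w @ [j]) (corner m')"
      using curve_leaves_cell_through_corner[OF g' wj] y_in by simp metis
    define q where "q = - r'"
    have q: "q \<in> {r..t}" "q \<in> {s..t}" and gq: "g q = cell_map w (sg_map j (corner m'))"
      using r' r gr' by (auto simp: q_def)
    from m' consider "m' = i" | "m' = j" | "m' = l" unfolding l(4) by blast
    then show ?thesis
    proof cases
      case 1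
      then show ?thesis using junction[OF q(2)] gq by (simp add: sg_map_corner_commute[of j i])
    next
      case 2
      then show ?thesis using outer_j[OF q(2)] gq by simp
    next
      case 3
      have "dist (sg_map i (corner l)) (sg_map j (corner l)) = 1 / 2"
        using dist_midpoint_midpoint[OF ij, of l] by (simp only: sg_map_corner_commute[of _ l])
      then have "dist (g r) (g q) = 1 / 2 / 2 ^ length w"
        unfolding gq gr_l 3 dist_cell_map by (rule arg_cong)
      then have side: "dist (g r) (g q) = 1 / ?N" by simp
      have "(1 - bary l y) / ?N \<le> L'" if "gasket_curve g q t L'" for L'
        using corner_distance_lower_reversed[OF wj l(1) y that _ finish'] gq 3 by simp
      from gasket_curve_drop_end[OF g q(2) this]
      have g1: "gasket_curve g s q (L - (1 - bary l y) / ?N)" .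
      have "r \<in> {s..q}" using r q by simp
      from gasket_curve_drop_end_dist[OF g1 this]
      have "gasket_curve g s r (L - (1 - bary l y) / ?N - 1 / ?N)" using side by simp
      from corner_distance_lower[OF wi l(1) x this start'] gr_l
      have "(1 - bary l x) / ?N \<le> L - (1 - bary l y) / ?N - 1 / ?N" by simp
      then have "1 / ?N + (1 - bary l x) / ?N + (1 - bary l y) / ?N \<le> L" by linarith
      then show ?thesis
        by (intro detour) (simp only: add_divide_distrib)
    qed
  qed
qed

section \<open>Codes and the distance formula\<close>

text \<open>Unrolling the recursion leaves the remainder \<open>y n / 2 ^ n\<close>, which vanishes in the limit.\<close>

lemma sums_of_halving_recursion:
  fixes y e :: "nat \<Rightarrow> real"
  assumes y: "\<And>n. y n = (e n + y (Suc n)) / 2" "\<And>n. y n \<in> {0..1}"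
  shows "(\<lambda>m. e m / 2 ^ Suc m) sums y 0"
proof -
  have partial: "(\<Sum>m<n. e m / 2 ^ Suc m) = y 0 - y n / 2 ^ n" for n
  proof (induction n)
    case (Suc n)
    have "y n / 2 ^ n = e n / 2 ^ Suc n + y (Suc n) / 2 ^ Suc n"
      by (subst y(1)) (simp add: add_divide_distrib)
    with Suc show ?case by simp
  qed simp
  have "(\<lambda>n. y n / 2 ^ n) \<longlonglongrightarrow> 0"
  proof (rule tendsto_sandwich[OF _ _ tendsto_const])
    show "(\<lambda>n. 1 / 2 ^ n :: real) \<longlonglongrightarrow> 0"
      by (intro LIMSEQ_divide_realpow_zero) simp
  qed (use y(2) in \<open>auto simp: divide_right_mono\<close>)
  then have "(\<lambda>n. y 0 - y n / 2 ^ n) \<longlonglongrightarrow> y 0 - 0"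
    by (intro tendsto_intros)
  then show ?thesis
    unfolding sums_def partial by simp
qed

definition code_prefix :: "(nat \<Rightarrow> nat) \<Rightarrow> nat \<Rightarrow> nat list" where
  "code_prefix c n = map c [1..<Suc n]"

lemma code_prefix_Suc: "code_prefix c (Suc n) = code_prefix c n @ [c (Suc n)]"
  by (simp add: code_prefix_def)

lemma length_code_prefix [simp]: "length (code_prefix c n) = n"
  by (simp add: code_prefix_def)

lemma code_prefix_letters:
  "(\<And>n. 1 \<le> n \<Longrightarrow> c n \<in> {0,1,2}) \<Longrightarrow> set (code_prefix c n) \<subseteq> {0,1,2}"
  unfolding code_prefix_def set_map set_upt by (intro image_subsetI) simp

lemma is_code_letter: "\<lbrakk>is_code c p; 1 \<le> n\<rbrakk> \<Longrightarrow> c n \<in> {0,1,2}"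
  unfolding is_code_def by blast

lemma is_code_tail:
  assumes "is_code c p"
  obtains q where "q \<in> gasket" "p = cell_map (code_prefix c n) q"
proof -
  note letters = is_code_letter[OF assms]
  have "p \<in> (\<Inter>k\<in>{1..}. sg_cell (map c [1..<Suc k]))"
    using assms unfolding is_code_def by simp
  then have "p \<in> sg_cell (code_prefix c (Suc n))"
    unfolding code_prefix_def by (rule INT_D) simp
  then obtain q where q: "q \<in> gasket" "p = cell_map (code_prefix c n) (sg_map (c (Suc n)) q)"
    unfolding sg_cell_def code_prefix_Suc by auto
  show ?thesis
    by (rule that[OF sg_map_gasket[OF letters q(1)] q(2)]) simp
qed

text \<open>
  Each cell map halves \<open>bary j\<close> and adds \<open>1 / 2\<close> exactly for the letter \<open>j\<close>, so the positions of \<open>j\<close> in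
  the tail of the code are binary digits.
\<close>

lemma bary_tail_sums:
  assumes c: "is_code c p" and q: "q \<in> gasket" "p = cell_map (code_prefix c k) q"
    and j: "j \<in> {0,1,2}"
  shows "(\<lambda>m. (if c (k + 1 + m) = j then 1 else 0) / 2 ^ Suc m) sums bary j q"
proof -
  note letters = is_code_letter[OF c]
  have "\<forall>n. \<exists>r. r \<in> gasket \<and> p = cell_map (code_prefix c (k + n)) r"
    using is_code_tail[OF c] by blast
  from choice[OF this] obtain r where r: "\<And>n. r n \<in> gasket"
      "\<And>n. p = cell_map (code_prefix c (k + n)) (r n)"
    by blast
  have "cell_map (code_prefix c k) q = cell_map (code_prefix c k) (r 0)"
    using q(2) r(2)[of 0] by simp
  then have "r 0 = q" by simp
  have step: "r n = sg_map (c (k + 1 + n)) (r (Suc n))" for n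
  proof -
    have "cell_map (code_prefix c (k + n)) (r n)
        = cell_map (code_prefix c (k + n)) (sg_map (c (k + 1 + n)) (r (Suc n)))"
      using r(2)[of n] r(2)[of "Suc n"] by (simp add: code_prefix_Suc)
    then show ?thesis by simp
  qed
  have "bary j (r n) = ((if c (k + 1 + n) = j then 1 else 0) + bary j (r (Suc n))) / 2" for n
  proof -
    have "c (k + 1 + n) \<in> {0,1,2}" by (rule letters) simp
    from bary_sg_map[OF j this, of "r (Suc n)", folded step[of n]] show ?thesis
      by (cases "c (k + 1 + n) = j") (simp_all only: add.commute if_True if_False simp_thms not_sym)
  qed
  moreover have "bary j (r n) \<in> {0..1}" for n
    using bary_nonneg[OF r(1) j] bary_le_one[OF r(1) j] by simp
  ultimately have "(\<lambda>m. (if c (k + 1 + m) = j then 1 else 0) / 2 ^ Suc m) sums bary j (r 0)"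
    by (rule sums_of_halving_recursion)
  then show ?thesis unfolding \<open>r 0 = q\<close> .
qed

lemma digit_series:
  assumes c: "is_code c p" and q: "q \<in> gasket" "p = cell_map (code_prefix c k) q"
    and j: "j \<in> {0,1,2}"
  shows "(\<lambda>m. (if c (k + 1 + m) = j then 0 else 1) / 2 ^ (k + 1 + m)) sums ((1 - bary j q) / 2 ^ k)"
proof -
  have "(\<lambda>m. 1 / 2 ^ Suc m :: real) sums 1"
    using power_half_series by (simp add: power_divide)
  from sums_diff[OF this bary_tail_sums[OF c q j]]
  have "(\<lambda>m. (1 / 2 ^ Suc m - (if c (k + 1 + m) = j then 1 else 0) / 2 ^ Suc m) / 2 ^ k)
      sums ((1 - bary j q) / 2 ^ k)"
    by (rule sums_divide)
  moreover have "(1 / 2 ^ Suc m - (if c (k + 1 + m) = j then 1 else 0) / 2 ^ Suc m) / 2 ^ k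
      = (if c (k + 1 + m) = j then 0 else 1 :: real) / 2 ^ (k + 1 + m)" for m
    by (simp add: power_add)
  ultimately show ?thesis by simp
qed

lemma gasket_has_code:
  assumes "p \<in> gasket" obtains c where "is_code c p"
proof -
  have "\<forall>x. \<exists>jy. x \<in> gasket \<longrightarrow> fst jy \<in> {0,1,2} \<and> snd jy \<in> gasket \<and> x = sg_map (fst jy) (snd jy)"
  proof
    fix x
    show "\<exists>jy. x \<in> gasket \<longrightarrow> fst jy \<in> {0,1,2} \<and> snd jy \<in> gasket \<and> x = sg_map (fst jy) (snd jy)"
    proof (cases "x \<in> gasket")
      case True
      then obtain j y where "j \<in> {0,1,2}" "y \<in> gasket" "x = sg_map j y"
        by (rule gasket_cases)
      then show ?thesis by (intro exI[of _ "(j, y)"]) simp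
    qed simp
  qed
  from choice[OF this] obtain f where f: "\<And>x. x \<in> gasket \<Longrightarrow> fst (f x) \<in> {0,1,2}"
      "\<And>x. x \<in> gasket \<Longrightarrow> snd (f x) \<in> gasket" "\<And>x. x \<in> gasket \<Longrightarrow> x = sg_map (fst (f x)) (snd (f x))"
    by metis
  define q where "q n = ((snd \<circ> f) ^^ n) p" for n
  define c where "c n = fst (f (q (n - 1)))" for n
  have q_Suc: "q (Suc n) = snd (f (q n))" for n by (simp add: q_def)
  have q: "q n \<in> gasket" for n
    by (induction n) (simp_all add: q_Suc f(2) q_def[of 0] assms)
  have letters: "c n \<in> {0,1,2}" for n
    unfolding c_def by (rule f(1)[OF q])
  have tail: "p = cell_map (code_prefix c n) (q n)" for n
  proof (induction n)
    case (Suc n)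
    then show ?case
      using f(3)[OF q[of n]] by (simp add: code_prefix_Suc c_def q_Suc)
  qed (simp add: code_prefix_def q_def)
  have "p \<in> sg_cell (code_prefix c n)" for n
    unfolding sg_cell_def using tail[of n] q[of n] by (rule image_eqI)
  moreover have "z = p" if z: "\<And>n. 1 \<le> n \<Longrightarrow> z \<in> sg_cell (code_prefix c n)" for z
  proof -
    obtain C where C: "\<And>x y. \<lbrakk>x \<in> gasket; y \<in> gasket\<rbrakk> \<Longrightarrow> dist x y \<le> C"
      using compact_imp_bounded[OF compact_gasket] by (metis bounded_two_points)
    have "dist z p \<le> C / 2 ^ n" if n: "1 \<le> n" for n
    proof -
      obtain y where y: "y \<in> gasket" "z = cell_map (code_prefix c n) y"
        using z[OF n] unfolding sg_cell_def by blast
      have "dist z p = dist y (q n) / 2 ^ n"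
        unfolding y(2) by (subst tail[of n]) (simp add: dist_cell_map)
      then show ?thesis
        using C[OF y(1) q[of n]] by (simp add: divide_right_mono)
    qed
    then have "\<exists>N. \<forall>n\<ge>N. dist z p \<le> C / 2 ^ n" by blast
    moreover have "(\<lambda>n. C / 2 ^ n) \<longlonglongrightarrow> 0"
      by (intro LIMSEQ_divide_realpow_zero) simp
    ultimately have "dist z p \<le> 0" by (intro LIMSEQ_le_const)
    then show ?thesis by simp
  qed
  ultimately have "(\<Inter>k\<in>{1..}. sg_cell (code_prefix c k)) = {p}"
    by (intro equalityI subsetI) (simp_all add: INT_iff)
  then have "is_code c p"
    unfolding is_code_def code_prefix_def using letters by simp
  then show ?thesis by (rule that)
qed

lemma is_code_imp_gasket:
  assumes "is_code c p" shows "p \<in> gasket"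
proof -
  obtain q where "q \<in> gasket" "p = cell_map (code_prefix c 0) q"
    using assms by (rule is_code_tail)
  then show ?thesis by (simp add: code_prefix_def)
qed

lemma is_code_cong:
  assumes "is_code u p" "is_code v q" "\<And>n. 1 \<le> n \<Longrightarrow> u n = v n" shows "p = q"
proof -
  have prefixes: "code_prefix u k = code_prefix v k" for k
    unfolding code_prefix_def using assms(3) by (intro map_cong) auto
  have "(\<Inter>k\<in>{1..}. sg_cell (code_prefix u k)) = {p}" "(\<Inter>k\<in>{1..}. sg_cell (code_prefix v k)) = {q}"
    using assms(1,2) unfolding is_code_def code_prefix_def by blast+
  then have "{p} = {q}" unfolding prefixes by (rule trans[OF sym])
  then show ?thesis by simp
qed

text \<open>
  The series in the definition are corner distances in the two cells that are separated by the
  first differing letters; a letter different from both of these is the third letter \<open>l\<close>.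
\<close>

lemma code_dist_geometric:
  assumes u: "is_code u a" and v: "is_code v b" and neq: "\<not> (\<forall>n\<ge>1. u n = v n)"
  obtains w i j l x y where "set w \<subseteq> {0,1,2}" "i \<in> {0,1,2}" "j \<in> {0,1,2}" "i \<noteq> j"
    "l \<in> {0,1,2}" "l \<noteq> i" "l \<noteq> j" "{0,1,2} = {i, j, l}" "x \<in> gasket" "y \<in> gasket"
    "a = cell_map w (sg_map i x)" "b = cell_map w (sg_map j y)"
    "code_dist u v = min (1 - bary j x + (1 - bary i y)) (1 + (1 - bary l x) + (1 - bary l y))
       / 2 ^ Suc (length w)"
proof -
  define k where "k = (LEAST n. 1 \<le> n \<and> u n \<noteq> v n)"
  have k: "1 \<le> k" "u k \<noteq> v k"
    using neq LeastI_ex[of "\<lambda>n. 1 \<le> n \<and> u n \<noteq> v n"] unfolding k_def by blast+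
  have agree: "u n = v n" if "1 \<le> n" "n < k" for n
    using not_less_Least[of n "\<lambda>n. 1 \<le> n \<and> u n \<noteq> v n"] that unfolding k_def by blast
  obtain k' where k': "k = Suc k'" using k(1) by (cases k) auto
  define w where "w = code_prefix u k'"
  have w_v: "w = code_prefix v k'"
    unfolding w_def code_prefix_def using agree k' by (intro map_cong) auto
  have w: "set w \<subseteq> {0,1,2}" and len: "Suc (length w) = k"
    unfolding w_def using code_prefix_letters is_code_letter[OF u] k' by blast (simp add: k')
  have i: "u k \<in> {0,1,2}" and j: "v k \<in> {0,1,2}"
    using is_code_letter[OF u k(1)] is_code_letter[OF v k(1)] .
  obtain l where l: "l \<in> {0,1,2}" "l \<noteq> u k" "l \<noteq> v k" "{0,1,2} = {u k, v k, l}"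
    using third_letter[OF i j k(2)] .
  obtain x where x: "x \<in> gasket" "a = cell_map (code_prefix u k) x"
    using is_code_tail[OF u] .
  obtain y where y: "y \<in> gasket" "b = cell_map (code_prefix v k) y"
    using is_code_tail[OF v] .
  have a: "a = cell_map w (sg_map (u k) x)" and b: "b = cell_map w (sg_map (v k) y)"
    using x(2) y(2) unfolding k' code_prefix_Suc w_v by (simp_all add: w_v[symmetric] w_def)
  have third: "(if z \<noteq> u k \<and> z \<noteq> v k then 0 else 1 :: real) = (if z = l then 0 else 1)"
    "(if z \<noteq> v k \<and> z \<noteq> u k then 0 else 1 :: real) = (if z = l then 0 else 1)"
    if "z \<in> {0,1,2}" for z
    using that l(2,3) unfolding l(4) by auto
  have letter: "1 \<le> k + 1 + m" for m by simp
  note sum_of_series = sums_add[OF digit_series[OF u x] digit_series[OF v y], folded add_divide_distrib]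
  have direct: "(\<Sum>m. ((if u (k + 1 + m) = v k then 0 else 1 :: real)
        + (if v (k + 1 + m) = u k then 0 else 1)) / 2 ^ (k + 1 + m))
      = (1 - bary (v k) x + (1 - bary (u k) y)) / 2 ^ k"
    using sums_unique[OF sum_of_series[OF j i]] by simp
  have detour: "(\<Sum>m. ((if u (k + 1 + m) \<noteq> u k \<and> u (k + 1 + m) \<noteq> v k then 0 else 1 :: real)
        + (if v (k + 1 + m) \<noteq> v k \<and> v (k + 1 + m) \<noteq> u k then 0 else 1)) / 2 ^ (k + 1 + m))
      = (1 - bary l x + (1 - bary l y)) / 2 ^ k"
    unfolding third(1)[OF is_code_letter[OF u letter]] third(2)[OF is_code_letter[OF v letter]]
    using sums_unique[OF sum_of_series[OF l(1) l(1)]] by simp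
  have "code_dist u v = min ((1 - bary (v k) x + (1 - bary (u k) y)) / 2 ^ k)
      (1 / 2 ^ k + (1 - bary l x + (1 - bary l y)) / 2 ^ k)"
    unfolding code_dist_def if_not_P[OF neq] Let_def k_def[symmetric] direct detour by (rule refl)
  also have "\<dots> = min (1 - bary (v k) x + (1 - bary (u k) y)) (1 + (1 - bary l x) + (1 - bary l y)) / 2 ^ k"
    by (simp add: min_divide_distrib_right add_divide_distrib add.assoc del: one_add_one)
  finally show ?thesis
    using that[OF w i j k(2) l x(1) y(1) a b] unfolding len by blast
qed

section \<open>The gasket distance is the intrinsic metric\<close>

text \<open>
  Each alternative of the minimum is the length of an explicit arc: through the common junction of
  the two cells, or through the third cell along one of its sides.
\<close>

lemma joined_code_dist:
  assumes u: "is_code u a" and v: "is_code v b"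
  shows "joined gasket a b (code_dist u v)"
proof (cases "\<forall>n\<ge>1. u n = v n")
  case True
  then have "a = b" using is_code_cong[OF u v] by blast
  then show ?thesis
    using True joined_refl[OF is_code_imp_gasket[OF u], of 0] by (simp add: code_dist_def)
next
  case False
  obtain w i j l x y where w: "set w \<subseteq> {0,1,2}" and ij: "i \<in> {0,1,2}" "j \<in> {0,1,2}" "i \<noteq> j"
    and l: "l \<in> {0,1,2}" "l \<noteq> i" "l \<noteq> j" "{0,1,2} = {i, j, l}"
    and xy: "x \<in> gasket" "y \<in> gasket"
    and ab: "a = cell_map w (sg_map i x)" "b = cell_map w (sg_map j y)"
    and d: "code_dist u v = min (1 - bary j x + (1 - bary i y))
      (1 + (1 - bary l x) + (1 - bary l y)) / 2 ^ Suc (length w)"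
    using code_dist_geometric[OF u v False] .
  let ?N = "2 ^ Suc (length w) :: real"
  have w_letter: "set (w @ [k]) \<subseteq> {0,1,2}" if "k \<in> {0,1,2}" for k
    using w that by simp
  have to_corner: "joined gasket (cell_map w (sg_map k z)) (cell_map w (sg_map k (corner m)))
      ((1 - bary m z) / ?N)" if "k \<in> {0,1,2}" "m \<in> {0,1,2}" "z \<in> gasket" for k m z
    using joined_cell_map[OF joined_sym[OF joined_corner[OF that(3,2)]] w_letter[OF that(1)]] by simp
  have junction: "sg_map k (corner m) = sg_map m (corner k)" for k m
    by (rule sg_map_corner_commute)
  have direct: "joined gasket a b ((1 - bary j x) / ?N + (1 - bary i y) / ?N)"
    using joined_trans[OF to_corner[OF ij(1,2) xy(1)]
        joined_sym[OF to_corner[OF ij(2,1) xy(2), unfolded junction[of j i]]]] ab by simp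
  have side: "joined gasket (cell_map w (sg_map i (corner l))) (cell_map w (sg_map j (corner l))) (1 / ?N)"
    using to_corner[OF l(1) ij(2) corner_in_gasket[OF ij(1)]] bary_corner[OF ij(2,1)] ij(3)
    by (simp add: junction[of l])
  have detour: "joined gasket a b ((1 - bary l x) / ?N + 1 / ?N + (1 - bary l y) / ?N)"
    using joined_trans[OF joined_trans[OF to_corner[OF ij(1) l(1) xy(1)] side]
        joined_sym[OF to_corner[OF ij(2) l(1) xy(2)]]] ab by simp
  show ?thesis
  proof (cases "1 - bary j x + (1 - bary i y) \<le> 1 + (1 - bary l x) + (1 - bary l y)")
    case True
    then have "code_dist u v = (1 - bary j x) / ?N + (1 - bary i y) / ?N"
      unfolding d add_divide_distrib[symmetric] by (simp only: min_absorb1)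
    then show ?thesis using direct by (simp only:)
  next
    case False
    then have "code_dist u v = (1 - bary l x) / ?N + 1 / ?N + (1 - bary l y) / ?N"
      unfolding d add_divide_distrib[symmetric] by (simp only: min_absorb2 linear not_le less_imp_le add.commute)
    then show ?thesis using detour by (simp only:)
  qed
qed

lemma code_dist_le_curve_length:
  assumes u: "is_code u a" and v: "is_code v b" and g: "g \<in> curves_joining gasket a b"
  shows "code_dist u v \<le> curve_length g"
proof (cases "\<forall>n\<ge>1. u n = v n")
  case True
  then show ?thesis
    using gasket_curve_nonneg[OF curves_joining_imp_gasket_curve[OF g]] by (simp add: code_dist_def)
next
  case False
  have "g 0 = a" "g 1 = b"
    using g by (auto simp: curves_joining_def pathstart_def pathfinish_def)
  then show ?thesis
    using code_dist_geometric[OF u v False]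
      adjacent_cells_distance_lower[OF _ _ _ _ _ _ _ _ _ _ curves_joining_imp_gasket_curve[OF g]]
    by metis
qed

text \<open>
  Independence of the codes is a by-product of the two bounds: an arc built from one pair of codes
  is subject to the lower bound from any other pair.
\<close>

lemma gasket_dist_eq_code_dist:
  assumes u: "is_code u a" and v: "is_code v b"
  shows "gasket_dist a b = code_dist u v"
proof -
  have le: "code_dist u v \<le> code_dist u' v'"
    if codes: "is_code u a" "is_code v b" "is_code u' a" "is_code v' b" for u v u' v'
  proof -
    obtain g where g: "g \<in> curves_joining gasket a b" "curve_length g \<le> code_dist u' v'"
      using joined_obtains_curve[OF joined_code_dist[OF codes(3,4)]] .
    show ?thesis
      using code_dist_le_curve_length[OF codes(1,2) g(1)] g(2) by (rule order_trans)
  qed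
  have "(THE r. \<exists>u v. is_code u a \<and> is_code v b \<and> r = code_dist u v) = code_dist u v"
  proof (rule the_equality)
    show "\<exists>u' v'. is_code u' a \<and> is_code v' b \<and> code_dist u v = code_dist u' v'"
      using u v by blast
    fix r assume "\<exists>u v. is_code u a \<and> is_code v b \<and> r = code_dist u v"
    then show "r = code_dist u v"
      using le u v by (metis order_antisym)
  qed
  then show ?thesis
    using is_code_imp_gasket[OF u] is_code_imp_gasket[OF v] by (simp add: gasket_dist_def)
qed

lemma joined_gasket_dist:
  assumes "a \<in> gasket" "b \<in> gasket" shows "joined gasket a b (gasket_dist a b)"
proof -
  obtain u v where "is_code u a" "is_code v b"
    using gasket_has_code assms by metis
  then show ?thesis
    using joined_code_dist gasket_dist_eq_code_dist by simp
qed

lemma gasket_dist_le_curve_length: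
  assumes "g \<in> curves_joining gasket a b" shows "gasket_dist a b \<le> curve_length g"
proof -
  have "a \<in> gasket" "b \<in> gasket"
    using assms by (auto simp: curves_joining_def)
  then obtain u v where "is_code u a" "is_code v b"
    using gasket_has_code by metis
  then show ?thesis
    using code_dist_le_curve_length[OF _ _ assms] gasket_dist_eq_code_dist by simp
qed

lemma gasket_dist_le_if_joined:
  assumes "joined gasket a b L" shows "gasket_dist a b \<le> L"
  using joined_obtains_curve[OF assms] gasket_dist_le_curve_length by (metis order_trans)

theorem proposition3p3:
  shows "Metric_space gasket gasket_dist \<and> strictly_intrinsic gasket gasket_dist"
proof
  show "Metric_space gasket gasket_dist"
  proof
    fix a b c
    show "0 \<le> gasket_dist a b"
    proof (cases "a \<in> gasket \<and> b \<in> gasket")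
      case True
      then show ?thesis using joined_gasket_dist unfolding joined_def by blast
    qed (auto simp: gasket_dist_def)
    show "gasket_dist a b = gasket_dist b a"
    proof (cases "a \<in> gasket \<and> b \<in> gasket")
      case True
      then show ?thesis
        using gasket_dist_le_if_joined[OF joined_sym[OF joined_gasket_dist]] by (metis order_antisym)
    qed (auto simp: gasket_dist_def)
    assume a: "a \<in> gasket" and b: "b \<in> gasket"
    show "gasket_dist a b = 0 \<longleftrightarrow> a = b"
    proof
      assume "gasket_dist a b = 0"
      then have "joined gasket a b 0" using joined_gasket_dist[OF a b] by simp
      then show "a = b" by (rule joined_zero_iff)
    next
      assume "a = b"
      then have "joined gasket a b 0" using joined_refl[OF a] by simp
      then show "gasket_dist a b = 0"
        using gasket_dist_le_if_joined \<open>0 \<le> gasket_dist a b\<close> by fastforce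
    qed
    assume c: "c \<in> gasket"
    show "gasket_dist a c \<le> gasket_dist a b + gasket_dist b c"
      by (intro gasket_dist_le_if_joined joined_trans[OF joined_gasket_dist joined_gasket_dist] a b c)
  qed
  show "strictly_intrinsic gasket gasket_dist"
    unfolding strictly_intrinsic_def
  proof (intro ballI conjI)
    fix a b assume "a \<in> gasket" "b \<in> gasket"
    then obtain g where g: "g \<in> curves_joining gasket a b" "curve_length g \<le> gasket_dist a b"
      using joined_obtains_curve[OF joined_gasket_dist] by blast
    have "curve_length g = gasket_dist a b"
      using g(2) gasket_dist_le_curve_length[OF g(1)] by (rule order_antisym)
    then show "\<exists>g\<in>curves_joining gasket a b. curve_length g = gasket_dist a b"
      using g(1) by (rule bexI)
    show "gasket_dist a b \<le> curve_length g" if "g \<in> curves_joining gasket a b" for g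
      using that by (rule gasket_dist_le_curve_length)
  qed
qed

end
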